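(* Let $d\ge1$, $n=d+1$, $\mathcal U=[0,1]^d$, and let $f:\mathcal U\to\mathbb R$ be such that all partial derivatives $\partial f/\partial\alpha_i$ and $\partial^2 f/\partial\alpha_i\partial\alpha_j$ exist and are continuous on $\mathcal U$, and suppose there is $\eta>0$ such that for all $\boldsymbol\alpha\in\mathcal U$ $$\left|\det\left(\frac{\partial^2 f}{\partial\alpha_i\partial\alpha_j}(\boldsymbol\alpha)\right)_{1\le i,j\le d}\right|\ge\eta .$$ Then there is a constant $C>0$ (depending on $f$ and $d$, but independent of $q$, $\boldsymbol\theta$ and $\psi$) such that for every $\boldsymbol\theta\in\mathbb R^n$, every function $\psi:[0,\infty)\to[0,\infty)$ with $\psi(r)\to0$ as $r\to\infty$, and every $q\in\mathbb N$ with $0<\psi(q)\le1/2$, $$A(q,\psi,\boldsymbol\theta)\le C\left(\psi(q)q^d+(q\psi(q))^{-d/2}q^d\max\{1,(\log(q\psi(q)))^d\}\right).$$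
   Context: For $\boldsymbol\theta=(\boldsymbol\lambda,\gamma)\in\mathbb R^d\times\mathbb R$ and $q\in\mathbb N$, let $$\mathcal R(q,\psi,\boldsymbol\theta)=\left\{(\mathbf a,b)\in\mathbb Z^d\times\mathbb Z:\ \tfrac{\mathbf a+\boldsymbol\lambda}{q}\in\mathcal U,\ \left|qf\!\left(\tfrac{\mathbf a+\boldsymbol\lambda}{q}\right)-\gamma-b\right|<\psi(q)\right\},$$ and $A(q,\psi,\boldsymbol\theta)=\#\mathcal R(q,\psi,\boldsymbol\theta)$. *)

theory Defs
  imports "HOL-Analysis.Analysis"
begin

abbreviation unit_cube :: "(real ^ 'd) set"
  where "unit_cube \<equiv> cbox 0 1"

lemma mem_unit_cube: "\<alpha> \<in> unit_cube \<longleftrightarrow> (\<forall>i. 0 \<le> \<alpha> $ i \<and> \<alpha> $ i \<le> 1)"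
  by (simp add: mem_box_cart)

(* The functions of interest are only given on S (here a closed cube), so the partial
   derivatives are taken within S: at a boundary point they are the one-sided ones.
   Values outside S play no role. *)

definition line_slice :: "(real ^ 'd) set \<Rightarrow> 'd \<Rightarrow> real ^ 'd \<Rightarrow> real set"
  where "line_slice S i \<alpha> = {t. \<alpha> + t *\<^sub>R axis i 1 \<in> S}"

definition has_partial_within ::
    "(real ^ 'd) set \<Rightarrow> 'd \<Rightarrow> (real ^ 'd \<Rightarrow> real) \<Rightarrow> real ^ 'd \<Rightarrow> bool"
  where "has_partial_within S i g \<alpha> \<longleftrightarrow>
    (\<lambda>t. g (\<alpha> + t *\<^sub>R axis i 1)) differentiable (at 0 within line_slice S i \<alpha>)"

definition partial_within ::
    "(real ^ 'd) set \<Rightarrow> 'd \<Rightarrow> (real ^ 'd \<Rightarrow> real) \<Rightarrow> real ^ 'd \<Rightarrow> real"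
  where "partial_within S i g \<alpha> =
    vector_derivative (\<lambda>t. g (\<alpha> + t *\<^sub>R axis i 1)) (at 0 within line_slice S i \<alpha>)"

definition C2_within :: "(real ^ 'd) set \<Rightarrow> (real ^ 'd \<Rightarrow> real) \<Rightarrow> bool"
  where "C2_within S f \<longleftrightarrow>
    (\<forall>i. (\<forall>\<alpha>\<in>S. has_partial_within S i f \<alpha>) \<and> continuous_on S (partial_within S i f)) \<and>
    (\<forall>i j. (\<forall>\<alpha>\<in>S. has_partial_within S i (partial_within S j f) \<alpha>) \<and>
       continuous_on S (partial_within S i (partial_within S j f)))"

definition hessian_within ::
    "(real ^ 'd) set \<Rightarrow> (real ^ 'd \<Rightarrow> real) \<Rightarrow> real ^ 'd \<Rightarrow> real ^ 'd ^ 'd"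
  where "hessian_within S f \<alpha> = (\<chi> i j. partial_within S i (partial_within S j f) \<alpha>)"

definition shifted_point :: "nat \<Rightarrow> real ^ 'd \<Rightarrow> int ^ 'd \<Rightarrow> real ^ 'd"
  where "shifted_point q l a = (\<chi> i. (of_int (a $ i) + l $ i) / real q)"

definition near_points ::
    "(real ^ 'd \<Rightarrow> real) \<Rightarrow> nat \<Rightarrow> (real \<Rightarrow> real) \<Rightarrow> (real ^ 'd) \<times> real \<Rightarrow> ((int ^ 'd) \<times> int) set"
  where "near_points f q \<psi> \<theta> =
    {(a, b). shifted_point q (fst \<theta>) a \<in> unit_cube \<and>
       \<bar>real q * f (shifted_point q (fst \<theta>) a) - snd \<theta> - of_int b\<bar> < \<psi> (real q)}"

end

theory Submission
  imports Defs
begin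

text \<open>
  Put $K = \lfloor\sqrt{q\psi(q)}\rfloor$ and cut the integer lattice into boxes of side $K$.
  On one box the graph of $qf$ is linear up to $O(\psi(q))$, so the near points in the box are
  detected by the squared exponential sum over $h < H$ with $H$ of order $1/\psi(q)$.
  Expanding the square, the diagonal contributes the term $\psi(q)q^d$, and a frequency
  difference $j = h - h'$ with $j \neq 0$ contributes, summed over the boxes, products of
  $\min(K, \|j\,\partial_i f\|^{-1})$.
  As the Hessian is nonsingular, the gradient separates nearby points, so only
  $O(q/(jK^2) + 1)^d$ boxes have $j\nabla f$ in a given cell of side $1/K$;
  summing over the cells gives $O((K \log K)^d (q/K^2 + H)^d)$ for every $j$.
\<close>

section \<open>Taylor bounds from partial derivatives\<close>

text \<open>\<open>K\<close> is the largest scale at which linearizing is harmless: over a box the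
  quadratic remainder of qf has order q (K/q)^2 = K^2/q, which must stay O(psi(q)). Then q/K^2 and H
  are both of order 1/psi(q), so the two parts of (q/K^2 + H)^d balance, and K/psi(q) has order q (q
  psi(q))^(-1/2), which is the second term of the theorem. The estimate is uniform in j by a
  cancellation: j times the gradient winds about |j| times around the circle in each coordinate, but
  a larger |j| also spreads the boxes over more cells. It is uniform in theta because gamma enters
  only through unimodular factors, which absolute values remove, while lambda only moves the
  representative points, of which just their distinct boxes and their lying in the cube are used.
  The Hessian controls the gradient only locally, so the cube is first divided into pieces of side
  1/P. If q psi(q) < 1 then K = 0 and the method is void, but there the trivial count is good
  enough.\<close>

lemma has_vector_derivative_slice:
  assumes "has_partial_within S i g (\<alpha> + t *\<^sub>R axis i 1)"
  shows "((\<lambda>\<tau>. g (\<alpha> + \<tau> *\<^sub>R axis i 1)) has_vector_derivative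
           partial_within S i g (\<alpha> + t *\<^sub>R axis i 1)) (at t within line_slice S i \<alpha>)"
proof -
  define \<phi> where "\<phi> = (\<lambda>\<tau>. g (\<alpha> + \<tau> *\<^sub>R axis i 1))"
  \<comment> \<open>A partial derivative at a point is taken at parameter 0 of the slice based
    there; subtracting \<open>t\<close> carries parameter \<open>t\<close> of the slice based at
    \<open>\<alpha>\<close> to it.\<close>
  have slice: "(\<lambda>\<tau>. \<tau> - t) ` line_slice S i \<alpha> = line_slice S i (\<alpha> + t *\<^sub>R axis i 1)"
  proof (intro equalityI subsetI)
    fix s assume "s \<in> line_slice S i (\<alpha> + t *\<^sub>R axis i 1)"
    then have "s + t \<in> line_slice S i \<alpha>"
      by (simp add: line_slice_def scaleR_add_left add_ac)
    then show "s \<in> (\<lambda>\<tau>. \<tau> - t) ` line_slice S i \<alpha>"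
      by (intro image_eqI[of _ _ "s + t"]) auto
  qed (auto simp: line_slice_def scaleR_diff_left)
  have "((\<lambda>s. g (\<alpha> + t *\<^sub>R axis i 1 + s *\<^sub>R axis i 1)) has_vector_derivative
      partial_within S i g (\<alpha> + t *\<^sub>R axis i 1)) (at 0 within line_slice S i (\<alpha> + t *\<^sub>R axis i 1))"
    using assms unfolding has_partial_within_def partial_within_def
    by (simp add: vector_derivative_works)
  then have "((\<lambda>s. \<phi> (t + s)) has_vector_derivative
      partial_within S i g (\<alpha> + t *\<^sub>R axis i 1)) (at (t - t) within (\<lambda>\<tau>. \<tau> - t) ` line_slice S i \<alpha>)"
    unfolding slice \<phi>_def by (simp add: scaleR_add_left add_ac)
  moreover have "((\<lambda>\<tau>. \<tau> - t) has_vector_derivative 1) (at t within line_slice S i \<alpha>)"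
    by (auto intro!: derivative_eq_intros)
  ultimately have "((\<lambda>s. \<phi> (t + s)) \<circ> (\<lambda>\<tau>. \<tau> - t) has_vector_derivative
      1 *\<^sub>R partial_within S i g (\<alpha> + t *\<^sub>R axis i 1)) (at t within line_slice S i \<alpha>)"
    by (intro vector_diff_chain_within)
  then show ?thesis by (simp add: o_def \<phi>_def)
qed

text \<open>Mean value inequality for g minus a linear function along an axis-parallel segment. The
  slope \<open>D\<close> is left free: 0 yields Lipschitz bounds, a partial at the base point yields
  Taylor bounds.\<close>

lemma partial_increment_bound:
  fixes g :: "real ^ 'd \<Rightarrow> real"
  assumes "convex S" "\<And>z. z \<in> S \<Longrightarrow> has_partial_within S i g z"
    and "\<alpha> \<in> S" "\<alpha> + s *\<^sub>R axis i 1 \<in> S"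
    and D: "\<And>\<tau>. \<tau> \<in> closed_segment 0 s \<Longrightarrow> \<bar>partial_within S i g (\<alpha> + \<tau> *\<^sub>R axis i 1) - D\<bar> \<le> \<epsilon>"
  shows "\<bar>g (\<alpha> + s *\<^sub>R axis i 1) - g \<alpha> - D * s\<bar> \<le> \<epsilon> * \<bar>s\<bar>"
proof -
  have sub: "\<alpha> + \<tau> *\<^sub>R axis i 1 \<in> S" if \<tau>: "\<tau> \<in> closed_segment 0 s" for \<tau>
  proof -
    obtain u where u: "0 \<le> u" "u \<le> 1" "\<tau> = u * s"
      using \<tau> by (auto simp: in_segment)
    have "(1 - u) *\<^sub>R \<alpha> + u *\<^sub>R (\<alpha> + s *\<^sub>R axis i 1) \<in> S"
      using assms u by (intro convexD_alt) auto
    then show ?thesis using u by (simp add: algebra_simps)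
  qed
  have der: "((\<lambda>\<tau>. g (\<alpha> + \<tau> *\<^sub>R axis i 1) - D * \<tau>) has_derivative
      (\<lambda>h. h * (partial_within S i g (\<alpha> + \<tau> *\<^sub>R axis i 1) - D))) (at \<tau> within closed_segment 0 s)"
    if "\<tau> \<in> closed_segment 0 s" for \<tau>
  proof -
    have "((\<lambda>\<tau>. g (\<alpha> + \<tau> *\<^sub>R axis i 1)) has_vector_derivative
        partial_within S i g (\<alpha> + \<tau> *\<^sub>R axis i 1)) (at \<tau> within closed_segment 0 s)"
      by (rule has_vector_derivative_within_subset[OF has_vector_derivative_slice])
        (use assms(2) sub that in \<open>auto simp: line_slice_def\<close>)
    then show ?thesis unfolding has_vector_derivative_def
      by (auto intro!: derivative_eq_intros simp: algebra_simps)
  qed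
  have "norm ((g (\<alpha> + s *\<^sub>R axis i 1) - D * s) - (g (\<alpha> + 0 *\<^sub>R axis i 1) - D * 0)) \<le> \<epsilon> * norm (s - 0)"
  proof (rule differentiable_bound[OF convex_closed_segment der])
    fix \<tau> assume t: "\<tau> \<in> closed_segment 0 s"
    show "onorm (\<lambda>h. h * (partial_within S i g (\<alpha> + \<tau> *\<^sub>R axis i 1) - D)) \<le> \<epsilon>"
    proof (rule onorm_bound)
      show "\<epsilon> \<ge> 0" using D[OF t] by linarith
      show "norm (h * (partial_within S i g (\<alpha> + \<tau> *\<^sub>R axis i 1) - D)) \<le> \<epsilon> * norm h" for h
        using mult_left_mono[OF D[OF t], of "\<bar>h\<bar>"] by (simp add: abs_mult mult.commute)
    qed
  qed auto
  then show ?thesis by (simp add: algebra_simps)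
qed

text \<open>Coordinates are changed one at a time from x' to x. The intermediate points
  \<open>mix T\<close> and the edges between them stay in the box, also at its boundary, so
  one-sided partials suffice and no total derivative is involved.\<close>

lemma partials_increment_bound:
  fixes g :: "real ^ 'd \<Rightarrow> real"
  assumes part: "\<And>i z. z \<in> cbox a b \<Longrightarrow> has_partial_within (cbox a b) i g z"
    and x: "x \<in> cbox a b" and x': "x' \<in> cbox a b"
    and D: "\<And>i z. z \<in> cbox a b \<Longrightarrow> (\<And>k. \<bar>z $ k - x' $ k\<bar> \<le> \<bar>x $ k - x' $ k\<bar>) \<Longrightarrow>
              \<bar>partial_within (cbox a b) i g z - D i\<bar> \<le> \<epsilon> i"
  shows "\<bar>g x - g x' - (\<Sum>i\<in>UNIV. D i * (x $ i - x' $ i))\<bar> \<le> (\<Sum>i\<in>UNIV. \<epsilon> i * \<bar>x $ i - x' $ i\<bar>)"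
proof -
  define mix where "mix = (\<lambda>T. \<chi> i. if i \<in> T then x $ i else x' $ i)"
  have "\<bar>g (mix T) - g x' - (\<Sum>i\<in>T. D i * (x $ i - x' $ i))\<bar> \<le> (\<Sum>i\<in>T. \<epsilon> i * \<bar>x $ i - x' $ i\<bar>)" for T
    using finite[of T]
  proof (induction T rule: finite_induct)
    case empty
    have "mix {} = x'" by (simp add: mix_def)
    then show ?case by simp
  next
    case (insert i T)
    let ?s = "x $ i - x' $ i"
    have mem: "mix T' \<in> cbox a b" for T'
      using x x' by (auto simp: mix_def mem_box_cart)
    have step: "mix (insert i T) = mix T + ?s *\<^sub>R axis i 1"
      using insert(2) by (auto simp: mix_def vec_eq_iff axis_def)
    have "\<bar>g (mix T + ?s *\<^sub>R axis i 1) - g (mix T) - D i * ?s\<bar> \<le> \<epsilon> i * \<bar>?s\<bar>"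
    proof (rule partial_increment_bound[OF convex_box(1) part])
      show "mix T \<in> cbox a b" by (rule mem)
      show "mix T + ?s *\<^sub>R axis i 1 \<in> cbox a b" using mem step by metis
      fix \<tau> assume "\<tau> \<in> closed_segment 0 ?s"
      then obtain u where u: "0 \<le> u" "u \<le> 1" "\<tau> = u * ?s"
        by (auto simp: in_segment)
      show "\<bar>partial_within (cbox a b) i g (mix T + \<tau> *\<^sub>R axis i 1) - D i\<bar> \<le> \<epsilon> i"
      proof (rule D)
        have "(1 - u) *\<^sub>R mix T + u *\<^sub>R mix (insert i T) \<in> cbox a b"
          using mem u by (intro convexD_alt convex_box) auto
        then show "mix T + \<tau> *\<^sub>R axis i 1 \<in> cbox a b"
          unfolding step u(3) by (simp add: algebra_simps)
        fix k
        have "\<bar>u * ?s\<bar> \<le> \<bar>?s\<bar>" using u by (simp add: abs_mult mult_left_le_one_le)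
        then show "\<bar>(mix T + \<tau> *\<^sub>R axis i 1) $ k - x' $ k\<bar> \<le> \<bar>x $ k - x' $ k\<bar>"
          using insert(2) u by (auto simp: mix_def axis_def)
      qed
    qed
    then show ?case using insert step by simp
  qed
  from this[of UNIV] show ?thesis by (simp add: mix_def)
qed

lemma partial_within_lipschitz:
  fixes f :: "real ^ 'd \<Rightarrow> real"
  assumes C2: "C2_within (cbox a b) f"
  obtains L where "L \<ge> 0"
    and "\<And>j x x'. x \<in> cbox a b \<Longrightarrow> x' \<in> cbox a b \<Longrightarrow>
      \<bar>partial_within (cbox a b) j f x - partial_within (cbox a b) j f x'\<bar> \<le> L * (\<Sum>i\<in>UNIV. \<bar>x $ i - x' $ i\<bar>)"
proof -
  have "\<exists>B. \<forall>x\<in>cbox a b. \<bar>partial_within (cbox a b) i (partial_within (cbox a b) j f) x\<bar> \<le> B" for i j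
  proof -
    have "compact (partial_within (cbox a b) i (partial_within (cbox a b) j f) ` cbox a b)"
      using C2 by (intro compact_continuous_image) (auto simp: C2_within_def)
    then show ?thesis
      by (auto dest!: compact_imp_bounded simp: bounded_iff)
  qed
  then obtain B where B: "\<And>i j x. x \<in> cbox a b \<Longrightarrow>
      \<bar>partial_within (cbox a b) i (partial_within (cbox a b) j f) x\<bar> \<le> B i j"
    by metis
  define L where "L = (\<Sum>i\<in>UNIV. \<Sum>j\<in>UNIV. \<bar>B i j\<bar>)"
  have BL: "\<bar>B i j\<bar> \<le> L" for i j
  proof -
    have "\<bar>B i j\<bar> \<le> (\<Sum>j\<in>UNIV. \<bar>B i j\<bar>)" by (rule member_le_sum) auto
    also have "\<dots> \<le> L" unfolding L_def
      by (rule member_le_sum[where f = "\<lambda>i. \<Sum>j\<in>UNIV. \<bar>B i j\<bar>"]) (auto intro: sum_nonneg)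
    finally show ?thesis .
  qed
  show ?thesis
  proof
    show "L \<ge> 0" unfolding L_def by (intro sum_nonneg) auto
    fix j x x' assume "x \<in> cbox a b" "x' \<in> cbox a b"
    \<comment> \<open>Slope 0 turns the increment estimate into a Lipschitz bound.\<close>
    then have "\<bar>partial_within (cbox a b) j f x - partial_within (cbox a b) j f x' -
        (\<Sum>i\<in>UNIV. 0 * (x $ i - x' $ i))\<bar> \<le> (\<Sum>i\<in>UNIV. L * \<bar>x $ i - x' $ i\<bar>)"
    proof (rule partials_increment_bound[rotated 1])
      fix i z assume "z \<in> cbox a b"
      then show "\<bar>partial_within (cbox a b) i (partial_within (cbox a b) j f) z - 0\<bar> \<le> L"
        using B[of z i j] BL[of i j] by linarith
    qed (use C2 in \<open>auto simp: C2_within_def\<close>)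
    then show "\<bar>partial_within (cbox a b) j f x - partial_within (cbox a b) j f x'\<bar>
        \<le> L * (\<Sum>i\<in>UNIV. \<bar>x $ i - x' $ i\<bar>)"
      by (simp add: sum_distrib_left)
  qed
qed

text \<open>On the way from x' to x each partial moves by at most L times the l1 distance, so
  freezing the slopes at x' leaves a quadratic remainder.\<close>

lemma C2_within_linearization:
  fixes f :: "real ^ 'd \<Rightarrow> real"
  assumes C2: "C2_within (cbox a b) f"
  obtains L where "L \<ge> 0"
    and "\<And>x x'. x \<in> cbox a b \<Longrightarrow> x' \<in> cbox a b \<Longrightarrow>
      \<bar>f x - f x' - (\<Sum>i\<in>UNIV. partial_within (cbox a b) i f x' * (x $ i - x' $ i))\<bar>
        \<le> L * (\<Sum>i\<in>UNIV. \<bar>x $ i - x' $ i\<bar>)\<^sup>2"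
proof -
  obtain L where L: "L \<ge> 0"
    and lip: "\<And>j x x'. x \<in> cbox a b \<Longrightarrow> x' \<in> cbox a b \<Longrightarrow>
      \<bar>partial_within (cbox a b) j f x - partial_within (cbox a b) j f x'\<bar> \<le> L * (\<Sum>i\<in>UNIV. \<bar>x $ i - x' $ i\<bar>)"
    using partial_within_lipschitz[OF C2] by blast
  show ?thesis
  proof
    fix x x' assume x: "x \<in> cbox a b" "x' \<in> cbox a b"
    let ?n = "\<Sum>i\<in>UNIV. \<bar>x $ i - x' $ i\<bar>"
    have "\<bar>f x - f x' - (\<Sum>i\<in>UNIV. partial_within (cbox a b) i f x' * (x $ i - x' $ i))\<bar>
        \<le> (\<Sum>i\<in>UNIV. L * ?n * \<bar>x $ i - x' $ i\<bar>)"
      using x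
    proof (rule partials_increment_bound[rotated 1])
      fix i z assume z: "z \<in> cbox a b" "\<And>k. \<bar>z $ k - x' $ k\<bar> \<le> \<bar>x $ k - x' $ k\<bar>"
      show "\<bar>partial_within (cbox a b) i f z - partial_within (cbox a b) i f x'\<bar> \<le> L * ?n"
        using lip[OF z(1) x(2)] by (rule order_trans) (intro mult_left_mono sum_mono z L)
    qed (use C2 in \<open>auto simp: C2_within_def\<close>)
    also have "\<dots> = L * ?n\<^sup>2"
      by (simp only: sum_distrib_left[symmetric] power2_eq_square mult.assoc)
    finally show "\<bar>f x - f x' - (\<Sum>i\<in>UNIV. partial_within (cbox a b) i f x' * (x $ i - x' $ i))\<bar>
        \<le> L * ?n\<^sup>2" .
  qed (rule L)
qed

section \<open>Quantitative local injectivity of the gradient\<close>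

lemma scaleR_vector_matrix_assoc: "(k *\<^sub>R v) v* A = k *\<^sub>R (v v* A)" for A :: "real ^ 'n ^ 'm"
  by (simp add: scalar_vector_matrix_assoc flip: scalar_mult_eq_scaleR)

text \<open>The norm is continuous and, by nonsingularity, positive on the compact product of
  \<open>S\<close> with the unit sphere; \<open>c\<close> is its minimum. The vector multiplies from
  the left because the row index of \<open>hessian_within\<close> is the outer derivative: component
  j is the derivative of the j-th partial along v.\<close>

lemma hessian_bounded_below:
  fixes f :: "real ^ 'd \<Rightarrow> real"
  assumes C2: "C2_within S f" and S: "compact S"
    and det: "\<And>x. x \<in> S \<Longrightarrow> det (hessian_within S f x) \<noteq> 0"
  obtains c where "c > 0"
    and "\<And>x v. x \<in> S \<Longrightarrow> c * norm v \<le> norm (v v* hessian_within S f x)"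
proof (cases "S = {}")
  case True
  then show ?thesis using that[of 1] by simp
next
  case False
  let ?K = "S \<times> sphere 0 1 :: ((real ^ 'd) \<times> (real ^ 'd)) set"
  let ?F = "\<lambda>p. norm (snd p v* hessian_within S f (fst p))"
  have "continuous_on ?K (\<lambda>p. snd p v* hessian_within S f (fst p))"
    unfolding vector_matrix_mult_def hessian_within_def
  proof (intro continuous_on_vec_lambda continuous_on_sum continuous_on_mult)
    fix i j
    have "continuous_on S (partial_within S i (partial_within S j f))"
      using C2 by (auto simp: C2_within_def)
    then have "continuous_on ?K (partial_within S i (partial_within S j f) \<circ> fst)"
      by (intro continuous_on_compose continuous_on_fst continuous_on_id) (auto intro: continuous_on_subset)
    then show "continuous_on ?K (\<lambda>p. (\<chi> i j. partial_within S i (partial_within S j f) (fst p)) $ i $ j)"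
      by (simp add: o_def)
  qed (intro continuous_intros)+
  then have cont: "continuous_on ?K ?F" by (rule continuous_on_norm)
  have "compact ?K" using S by (intro compact_Times) auto
  moreover have "?K \<noteq> {}" using False vector_choose_size[of 1] by (auto simp: dist_norm)
  ultimately obtain p where p: "p \<in> ?K" and min: "\<And>p'. p' \<in> ?K \<Longrightarrow> ?F p \<le> ?F p'"
    using continuous_attains_inf[OF _ _ cont] by blast
  have "?F p > 0"
  proof (rule ccontr)
    assume "\<not> ?F p > 0"
    then have "transpose (hessian_within S f (fst p)) *v snd p = 0" by simp
    moreover have "invertible (transpose (hessian_within S f (fst p)))"
      using det p by (auto simp: invertible_det_nz det_transpose)
    ultimately have "snd p = 0"
      by (metis invertible_def matrix_left_invertible_ker)
    then show False using p by auto
  qed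
  show ?thesis
  proof
    fix x v assume x: "x \<in> S"
    show "?F p * norm v \<le> norm (v v* hessian_within S f x)"
    proof (cases "v = 0")
      case False
      have "?F p \<le> ?F (x, v /\<^sub>R norm v)" using x False by (intro min) (auto simp: dist_norm)
      also have "\<dots> = norm (v v* hessian_within S f x) / norm v"
        by (simp add: scaleR_vector_matrix_assoc divide_inverse_commute)
      finally show ?thesis using False by (simp add: field_simps)
    qed simp
  qed fact
qed

lemma gradient_locally_injective:
  fixes f :: "real ^ 'd \<Rightarrow> real"
  assumes C2: "C2_within (cbox a b) f"
    and det: "\<And>x. x \<in> cbox a b \<Longrightarrow> det (hessian_within (cbox a b) f x) \<noteq> 0"
  obtains c \<delta> where "c > 0" "\<delta> > 0"
    and "\<And>x x' s i. x \<in> cbox a b \<Longrightarrow> x' \<in> cbox a b \<Longrightarrow> (\<And>i. \<bar>x $ i - x' $ i\<bar> \<le> \<delta>) \<Longrightarrow>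
      (\<And>j. \<bar>partial_within (cbox a b) j f x - partial_within (cbox a b) j f x'\<bar> \<le> s) \<Longrightarrow>
      c * \<bar>x $ i - x' $ i\<bar> \<le> s"
proof -
  let ?S = "cbox a b"
  let ?H = "\<lambda>i j. partial_within ?S i (partial_within ?S j f)"
  let ?d = "real CARD('d)"
  obtain c where c: "c > 0" and H: "\<And>x v. x \<in> ?S \<Longrightarrow> c * norm v \<le> norm (v v* hessian_within ?S f x)"
    using hessian_bounded_below[OF C2 compact_cbox det] by blast
  \<comment> \<open>Each of the d components of the gradient increment carries d errors of size at
    most \<open>\<epsilon> * norm v\<close>; this choice makes their total half of
    \<open>c * norm v\<close>.\<close>
  define \<epsilon> where "\<epsilon> = c / (2 * ?d * ?d)"
  have "\<epsilon> > 0" using c by (simp add: \<epsilon>_def)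
  have "\<exists>r>0. \<forall>x\<in>?S. \<forall>z\<in>?S. dist z x < r \<longrightarrow> \<bar>?H i j z - ?H i j x\<bar> < \<epsilon>" for i j
  proof -
    have "uniformly_continuous_on ?S (?H i j)"
      using C2 by (intro compact_uniformly_continuous) (auto simp: C2_within_def)
    then show ?thesis using \<open>\<epsilon> > 0\<close> by (auto simp: uniformly_continuous_on_def dist_real_def)
  qed
  then obtain r where r: "\<And>i j. r i j > 0"
    "\<And>i j x z. x \<in> ?S \<Longrightarrow> z \<in> ?S \<Longrightarrow> dist z x < r i j \<Longrightarrow> \<bar>?H i j z - ?H i j x\<bar> < \<epsilon>"
    by metis
  define \<rho> where "\<rho> = Min (range (\<lambda>(i, j). r i j))"
  have \<rho>: "\<rho> > 0" "\<rho> \<le> r i j" for i j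
    using r(1) unfolding \<rho>_def by (auto simp: Min_gr_iff intro!: Min_le)
  \<comment> \<open>Coordinates within \<open>\<delta>\<close> give an l1 distance of at most
    \<open>\<rho> / 2\<close>, strictly below the modulus of continuity.\<close>
  define \<delta> where "\<delta> = \<rho> / (2 * ?d)"
  show ?thesis
  proof (rule that[of "c / (2 * ?d)" \<delta>])
    show "c / (2 * ?d) > 0" "\<delta> > 0" using c \<rho> by (auto simp: \<delta>_def)
    fix x x' s i0
    assume x: "x \<in> ?S" "x' \<in> ?S" and near: "\<And>i. \<bar>x $ i - x' $ i\<bar> \<le> \<delta>"
      and s: "\<And>j. \<bar>partial_within ?S j f x - partial_within ?S j f x'\<bar> \<le> s"
    define v where "v = x - x'"
    have vi: "\<bar>x $ i - x' $ i\<bar> \<le> norm v" for i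
      using component_le_norm_cart[of v i] by (simp add: v_def)
    have "\<bar>(v v* hessian_within ?S f x') $ j\<bar> \<le> s + ?d * (\<epsilon> * norm v)" for j
    proof -
      have "\<bar>partial_within ?S j f x - partial_within ?S j f x' - (\<Sum>i\<in>UNIV. ?H i j x' * (x $ i - x' $ i))\<bar>
          \<le> (\<Sum>i\<in>UNIV. \<epsilon> * \<bar>x $ i - x' $ i\<bar>)"
        using x
      proof (rule partials_increment_bound[rotated 1])
        fix i z assume z: "z \<in> ?S" "\<And>k. \<bar>z $ k - x' $ k\<bar> \<le> \<bar>x $ k - x' $ k\<bar>"
        have "dist z x' \<le> (\<Sum>k\<in>UNIV. \<bar>(z - x') $ k\<bar>)" unfolding dist_norm by (rule norm_le_l1_cart)
        also have "\<dots> \<le> (\<Sum>k\<in>(UNIV::'d set). \<delta>)"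
          using z(2) near by (intro sum_mono) (auto intro: order_trans)
        also have "\<dots> < \<rho>" using \<rho>(1) by (simp add: \<delta>_def)
        finally show "\<bar>?H i j z - ?H i j x'\<bar> \<le> \<epsilon>"
          using r(2)[of x' z i j] x z \<rho>(2)[of i j] by fastforce
      qed (use C2 in \<open>auto simp: C2_within_def\<close>)
      also have "\<dots> \<le> (\<Sum>i\<in>(UNIV :: 'd set). \<epsilon> * norm v)"
        using vi \<open>\<epsilon> > 0\<close> by (intro sum_mono mult_left_mono) auto
      finally have "\<bar>partial_within ?S j f x - partial_within ?S j f x' - (v v* hessian_within ?S f x') $ j\<bar>
          \<le> ?d * (\<epsilon> * norm v)"
        by (simp add: vector_matrix_mult_def hessian_within_def v_def mult.commute)
      then show ?thesis using s[of j] by linarith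
    qed
    then have "(\<Sum>j\<in>UNIV. \<bar>(v v* hessian_within ?S f x') $ j\<bar>) \<le> (\<Sum>j\<in>(UNIV::'d set). s + ?d * (\<epsilon> * norm v))"
      by (intro sum_mono)
    then have "c * norm v \<le> ?d * (s + ?d * (\<epsilon> * norm v))"
      using H[OF x(2), of v] norm_le_l1_cart[of "v v* hessian_within ?S f x'"] by simp
    also have "\<dots> = ?d * s + c * norm v / 2"
      by (simp add: \<epsilon>_def field_simps)
    finally have "c / (2 * ?d) * norm v \<le> s" by (simp add: field_simps)
    moreover have "c / (2 * ?d) * \<bar>x $ i0 - x' $ i0\<bar> \<le> c / (2 * ?d) * norm v"
      using vi c by (intro mult_left_mono) auto
    ultimately show "c / (2 * ?d) * \<bar>x $ i0 - x' $ i0\<bar> \<le> s" by linarith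
  qed
qed

section \<open>Exponential sums\<close>

text \<open>For x = pi t at most 2, the cubic Taylor bound gives sin x >= x - x^3/6 >= x/3, and pi >
  3 turns x/3 into t.\<close>

lemma sin_pi_ge:
  assumes "0 \<le> t" "t \<le> 1 / 2"
  shows "t \<le> sin (pi * t)"
proof -
  define x where "x = pi * t"
  have x: "0 \<le> x" "x \<le> 2" using assms pi_half_less_two
    by (auto simp: x_def intro: order_trans[OF mult_left_mono[of t "1/2" pi]])
  have "\<bar>sin x - x\<bar> \<le> x ^ 3 / 6"
    using Maclaurin_sin_bound[of x 3] x by (simp add: sin_coeff_def eval_nat_numeral)
  moreover have "x ^ 3 \<le> x * 2\<^sup>2"
    unfolding power3_eq_cube power2_eq_square mult.assoc using x by (intro mult_mono) auto
  moreover have "3 * t \<le> x" using assms pi_gt3 by (auto simp: x_def intro: mult_right_mono)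
  ultimately have "t \<le> sin x" using x by (simp add: abs_if split: if_splits)
  then show ?thesis by (simp add: x_def)
qed

text \<open>The assumptions say that \<open>\<tau>\<close> is at most the distance from t to the
  nearest integer; periodicity and the reflection u -> 1 - u reduce to
  \<open>sin_pi_ge\<close>.\<close>

lemma abs_sin_pi_ge:
  assumes "0 \<le> \<tau>" "\<tau> \<le> t - of_int \<lfloor>t\<rfloor>" "\<tau> \<le> of_int \<lfloor>t\<rfloor> + 1 - t"
  shows "\<tau> \<le> \<bar>sin (pi * t)\<bar>"
proof -
  define u where "u = t - of_int \<lfloor>t\<rfloor>"
  have "pi * t = pi * u + of_int \<lfloor>t\<rfloor> * pi" by (simp add: u_def algebra_simps)
  then have "\<bar>sin (pi * t)\<bar> = \<bar>sin (pi * u)\<bar>"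
    by (simp add: sin_add abs_mult mult.commute[of _ pi])
  moreover have "\<tau> \<le> sin (pi * u)"
  proof (cases "u \<le> 1 / 2")
    case True
    then show ?thesis using sin_pi_ge[of u] assms by (simp add: u_def)
  next
    case False
    have "u < 1" unfolding u_def by linarith
    moreover have "sin (pi * u) = sin (pi * (1 - u))" by (simp add: right_diff_distrib)
    ultimately show ?thesis using sin_pi_ge[of "1 - u"] False assms by (simp add: u_def)
  qed
  ultimately show ?thesis by linarith
qed

lemma norm_cis_2pi_minus_1: "norm (cis (2 * pi * t) - 1) = 2 * \<bar>sin (pi * t)\<bar>"
proof -
  have "cis (2 * pi * t) - 1 = cis (pi * t) * (2 * \<i> * complex_of_real (sin (pi * t)))"
    using sin_double[of "pi * t"] cos_double_sin[of "pi * t"]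
    by (simp add: complex_eq_iff power2_eq_square mult.assoc)
  then show ?thesis by (simp add: norm_mult)
qed

text \<open>The usual bound by the smaller of K and the reciprocal distance to the integers,
  coarsened to depend only on \<open>r\<close>, the index of the interval of length 1/K that
  contains t modulo 1. In this form it can be summed over residues.\<close>

lemma geometric_cis_bound:
  fixes K :: nat and t :: real
  assumes K: "K > 0"
  defines "r \<equiv> nat (\<lfloor>K * t\<rfloor> mod int K)"
  shows "norm (\<Sum>k<K. cis (2 * pi * (t * k))) \<le> 2 * real K * (1 / real (Suc r) + 1 / real (K - r))"
proof -
  have r: "r < K" using K by (simp add: r_def nat_less_iff)
  have triv: "norm (\<Sum>k<K. cis (2 * pi * (t * k))) \<le> K"
    by (rule order_trans[OF norm_sum]) simp
  show ?thesis
  \<comment> \<open>In the two intervals next to an integer the distance may vanish, and only the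
    trivial bound \<open>K\<close> is available.\<close>
  proof (cases "r = 0 \<or> K - r = 1")
    case True
    then have "1 \<le> 1 / real (Suc r) + 1 / real (K - r)" by auto
    then have "2 * real K * 1 \<le> 2 * real K * (1 / real (Suc r) + 1 / real (K - r))"
      by (intro mult_left_mono) auto
    with triv show ?thesis by linarith
  next
    case False
    define n where "n = \<lfloor>K * t\<rfloor> div int K"
    have fl: "\<lfloor>K * t\<rfloor> = n * int K + int r"
      using K by (simp add: n_def r_def)
    then have "real_of_int (n * int K + int r) \<le> K * t" "K * t < real_of_int (n * int K + int r) + 1"
      by (simp_all add: floor_eq_iff)
    then have t: "n + r / K \<le> t" "t < n + (r + 1) / K"
      using K by (simp_all add: field_simps)
    have "(r + 1) / K \<le> 1" "real r / K \<ge> 0" using r by (auto simp: field_simps)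
    then have "\<lfloor>t\<rfloor> = n" using t unfolding floor_eq_iff by linarith
    \<comment> \<open>The fractional part of t lies between r/K and (r + 1)/K, so
      \<open>\<tau>\<close> bounds the distance to both neighbouring integers from below.\<close>
    define \<tau> where "\<tau> = min (real r) (real (K - r) - 1) / K"
    have \<tau>: "\<tau> > 0" using r False K by (auto simp: \<tau>_def)
    have "\<tau> \<le> r / K" "\<tau> \<le> 1 - (r + 1) / K"
      using r K by (auto simp: \<tau>_def field_simps of_nat_diff)
    then have sin: "\<tau> \<le> \<bar>sin (pi * t)\<bar>"
      using t \<tau> \<open>\<lfloor>t\<rfloor> = n\<close> by (intro abs_sin_pi_ge) auto
    let ?z = "cis (2 * pi * t)"
    have "(\<Sum>k<K. cis (2 * pi * (t * k))) = (\<Sum>k<K. ?z ^ k)"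
      by (intro sum.cong refl) (simp only: Complex.DeMoivre mult_ac)
    moreover have "(?z - 1) * (\<Sum>k<K. ?z ^ k) = ?z ^ K - 1"
      by (simp add: power_diff_1_eq)
    moreover have "norm (?z ^ K - 1) \<le> 2"
      using norm_triangle_ineq4[of "?z ^ K" 1] by (simp add: norm_power)
    ultimately have "2 * \<bar>sin (pi * t)\<bar> * norm (\<Sum>k<K. cis (2 * pi * (t * k))) \<le> 2"
      by (metis norm_cis_2pi_minus_1 norm_mult)
    moreover have "\<tau> * norm (\<Sum>k<K. cis (2 * pi * (t * k))) \<le> \<bar>sin (pi * t)\<bar> * norm (\<Sum>k<K. cis (2 * pi * (t * k)))"
      using sin by (intro mult_right_mono) auto
    ultimately have "norm (\<Sum>k<K. cis (2 * pi * (t * k))) \<le> 1 / \<tau>"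
      using \<tau> by (simp add: field_simps)
    also have "1 / \<tau> \<le> 2 * real K * (1 / real (Suc r) + 1 / real (K - r))"
    proof -
      \<comment> \<open>Replacing r by r + 1 and K - r - 1 by K - r costs a factor 2, and the result
        also covers the two extreme intervals.\<close>
      have half: "1 / x \<le> 2 * (1 / (x + 1))" if "x \<ge> 1" for x :: real
        using that by (simp add: field_simps)
      have "1 / min (real r) (real (K - r) - 1) \<le> 1 / real r + 1 / (real (K - r) - 1)"
        using False r by (auto simp: min_def)
      also have "\<dots> \<le> 2 * (1 / (real r + 1)) + 2 * (1 / (real (K - r) - 1 + 1))"
        using False r by (intro add_mono half) auto
      finally have "K * (1 / min (real r) (real (K - r) - 1)) \<le> K * (2 * (1 / real (Suc r) + 1 / real (K - r)))"
        by (intro mult_left_mono) (auto simp: algebra_simps)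
      then show ?thesis by (simp add: \<tau>_def algebra_simps)
    qed
    finally show ?thesis .
  qed
qed

section \<open>Near points detected by the squared exponential sum\<close>

lemma norm_cis_sum_power2:
  fixes H :: nat
  shows "complex_of_real ((norm (\<Sum>h<H. cis (2 * pi * (real h * X))))\<^sup>2) =
     (\<Sum>h<H. \<Sum>h'<H. cis (2 * pi * ((real h - real h') * X)))"
proof -
  have "complex_of_real ((norm (\<Sum>h<H. cis (2 * pi * (real h * X))))\<^sup>2) =
      (\<Sum>h<H. cis (2 * pi * (real h * X))) * cnj (\<Sum>h<H. cis (2 * pi * (real h * X)))"
    by (simp only: complex_norm_square)
  also have "\<dots> = (\<Sum>h<H. \<Sum>h'<H. cis (2 * pi * (real h * X)) * cis (- (2 * pi * (real h' * X))))"
    by (simp add: sum_product cis_cnj)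
  also have "\<dots> = (\<Sum>h<H. \<Sum>h'<H. cis (2 * pi * ((real h - real h') * X)))"
    by (simp add: cis_mult algebra_simps)
  finally show ?thesis .
qed

text \<open>The factor 6 keeps every phase within pi/3 of a multiple of 2 pi, so each of the
  \<open>H\<close> terms has real part at least 1/2.\<close>

lemma cis_sum_near_int:
  fixes H :: nat
  assumes "6 * (real H - 1) * \<bar>X - of_int b\<bar> \<le> 1"
  shows "(real H)\<^sup>2 \<le> 4 * (norm (\<Sum>h<H. cis (2 * pi * (real h * X))))\<^sup>2"
proof -
  define t where "t = X - of_int b"
  have "1 / 2 \<le> Re (cis (2 * pi * (real h * X)))" if "h < H" for h
  proof -
    have "6 * (real h * \<bar>t\<bar>) \<le> 6 * ((real H - 1) * \<bar>t\<bar>)"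
      using that by (intro mult_left_mono mult_right_mono) auto
    moreover have "6 * ((real H - 1) * \<bar>t\<bar>) \<le> 1" using assms unfolding t_def mult.assoc .
    ultimately have "\<bar>real h * t\<bar> \<le> 1 / 6" by (simp add: abs_mult)
    then have "2 * pi * \<bar>real h * t\<bar> \<le> 2 * pi * (1 / 6)" by (intro mult_left_mono) auto
    then have "cos (pi / 3) \<le> cos (\<bar>2 * pi * (h * t)\<bar>)"
      by (intro cos_monotone_0_pi_le) (auto simp: abs_mult)
    moreover have "cis (2 * pi * (real h * X)) = cis (2 * pi * (h * t)) * cis (2 * pi * of_int (int h * b))"
      by (simp add: t_def cis_mult algebra_simps)
    moreover have "cis (2 * pi * of_int (int h * b)) = 1"
      by (rule cis_multiple_2pi) auto
    ultimately show ?thesis by (simp add: cos_60)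
  qed
  then have "(\<Sum>h<H. 1 / 2) \<le> Re (\<Sum>h<H. cis (2 * pi * (real h * X)))"
    unfolding Re_sum by (intro sum_mono) auto
  then have "real H / 2 \<le> norm (\<Sum>h<H. cis (2 * pi * (real h * X)))"
    using complex_Re_le_cmod[of "\<Sum>h<H. cis (2 * pi * (real h * X))"] by simp
  then have "(real H / 2)\<^sup>2 \<le> (norm (\<Sum>h<H. cis (2 * pi * (real h * X))))\<^sup>2"
    by (intro power_mono) auto
  then show ?thesis by (simp add: power_divide)
qed

lemma cis_sum_box:
  fixes y :: "'i :: finite \<Rightarrow> real"
  shows "(\<Sum>k\<in>PiE UNIV (\<lambda>_. {..<K}). cis (2 * pi * (c + (\<Sum>i\<in>UNIV. y i * real (k i))))) =
     cis (2 * pi * c) * (\<Prod>i\<in>UNIV. \<Sum>k<K. cis (2 * pi * (y i * real k)))"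
proof -
  have "cis (2 * pi * (c + (\<Sum>i\<in>UNIV. y i * real (k i)))) =
      cis (2 * pi * c) * (\<Prod>i\<in>UNIV. cis (2 * pi * (y i * real (k i))))" for k :: "'i \<Rightarrow> nat"
    by (simp add: cis_conv_exp exp_add ring_distribs sum_distrib_left exp_sum)
  then show ?thesis
    by (simp add: prod_sum_PiE sum_distrib_left)
qed

text \<open>Each element of \<open>A\<close> carries weight at least H^2/4 in the squared sum, and
  the weight is nonnegative everywhere, so the sum may be extended to the whole box. There the
  affine phase factors into one geometric sum per coordinate, and \<open>c\<close> leaves only a
  unimodular factor.\<close>

lemma box_count:
  fixes y :: "'i :: finite \<Rightarrow> real" and c :: real
  assumes A: "A \<subseteq> PiE UNIV (\<lambda>_. {..<K})"
    and near: "\<And>k. k \<in> A \<Longrightarrow> \<exists>b. 6 * (real H - 1) * \<bar>c + (\<Sum>i\<in>UNIV. y i * real (k i)) - of_int b\<bar> \<le> 1"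
  shows "(real H)\<^sup>2 * real (card A) \<le>
     4 * (\<Sum>h<H. \<Sum>h'<H. \<Prod>i\<in>UNIV. norm (\<Sum>k<K. cis (2 * pi * ((real h - real h') * y i * real k))))"
proof -
  let ?B = "PiE UNIV (\<lambda>_ :: 'i. {..<K})"
  let ?X = "\<lambda>k. c + (\<Sum>i\<in>UNIV. y i * real (k i))"
  let ?S = "\<lambda>k. (norm (\<Sum>h<H. cis (2 * pi * (real h * ?X k))))\<^sup>2"
  have fin: "finite ?B" by (intro finite_PiE) auto
  have "(real H)\<^sup>2 * real (card A) = (\<Sum>k\<in>A. (real H)\<^sup>2)" by simp
  also have "\<dots> \<le> (\<Sum>k\<in>A. 4 * ?S k)"
    using near cis_sum_near_int by (intro sum_mono) blast
  also have "\<dots> \<le> (\<Sum>k\<in>?B. 4 * ?S k)"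
    by (intro sum_mono2 A fin) auto
  \<comment> \<open>A sum of nonnegative reals equals the norm of its complex copy; this prepares
    the triangle inequality after the square is expanded.\<close>
  also have "\<dots> = 4 * norm (\<Sum>k\<in>?B. complex_of_real (?S k))"
    by (simp add: sum_nonneg flip: sum_distrib_left of_real_sum of_real_power)
  also have "(\<Sum>k\<in>?B. complex_of_real (?S k)) =
      (\<Sum>k\<in>?B. \<Sum>h<H. \<Sum>h'<H. cis (2 * pi * ((real h - real h') * ?X k)))"
    by (simp only: norm_cis_sum_power2)
  also have "\<dots> = (\<Sum>h<H. \<Sum>h'<H. \<Sum>k\<in>?B. cis (2 * pi * ((real h - real h') * ?X k)))"
    by (subst sum.swap, rule sum.cong[OF refl], rule sum.swap)
  also have "\<dots> = (\<Sum>h<H. \<Sum>h'<H. cis (2 * pi * ((real h - real h') * c)) *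
      (\<Prod>i\<in>UNIV. \<Sum>k<K. cis (2 * pi * ((real h - real h') * y i * real k))))"
  proof -
    have "(real h - real h') * ?X k =
        (real h - real h') * c + (\<Sum>i\<in>UNIV. (real h - real h') * y i * real (k i))" for h h' k
      by (simp add: ring_distribs(1) sum_distrib_left mult.assoc)
    then show ?thesis by (simp only: cis_sum_box)
  qed
  also have "4 * norm \<dots> \<le> 4 * (\<Sum>h<H. \<Sum>h'<H. \<Prod>i\<in>UNIV.
      norm (\<Sum>k<K. cis (2 * pi * ((real h - real h') * y i * real k))))"
    by (intro mult_left_mono sum_norm_le) (auto simp: norm_mult prod_norm[symmetric])
  finally show ?thesis .
qed

section \<open>Lattice counts and sums over residue cells\<close>

lemma card_int_vec_bounded:
  fixes T :: "(int ^ 'd) set"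
  assumes R: "R \<ge> 0" and T: "\<And>m m' i. m \<in> T \<Longrightarrow> m' \<in> T \<Longrightarrow> \<bar>real_of_int (m $ i - m' $ i)\<bar> \<le> R"
  shows "finite T" and "real (card T) \<le> (2 * R + 1) ^ CARD('d)"
proof -
  have "finite T \<and> real (card T) \<le> (2 * R + 1) ^ CARD('d)"
  proof (cases "T = {}")
    case True
    then show ?thesis using R by simp
  next
    case False
    then obtain m0 where m0: "m0 \<in> T" by blast
    let ?B = "PiE UNIV (\<lambda>i. {m0 $ i - \<lfloor>R\<rfloor>..m0 $ i + \<lfloor>R\<rfloor>})"
    have fin: "finite ?B" by (intro finite_PiE) auto
    have inj: "inj_on vec_nth T" by (auto simp: inj_on_def vec_nth_inject)
    have sub: "vec_nth ` T \<subseteq> ?B"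
    proof (intro image_subsetI PiE_I)
      fix m i assume "m \<in> T"
      then have "\<bar>m $ i - m0 $ i\<bar> \<le> \<lfloor>R\<rfloor>"
        using T[OF _ m0] by (subst le_floor_iff) simp
      then show "m $ i \<in> {m0 $ i - \<lfloor>R\<rfloor>..m0 $ i + \<lfloor>R\<rfloor>}" by auto
    qed auto
    have "card T \<le> card ?B"
      using card_mono[OF fin sub] card_image[OF inj] by simp
    also have "\<dots> = nat (2 * \<lfloor>R\<rfloor> + 1) ^ CARD('d)"
      by (simp add: card_PiE algebra_simps)
    finally have "real (card T) \<le> real (nat (2 * \<lfloor>R\<rfloor> + 1)) ^ CARD('d)"
      by (metis of_nat_le_iff of_nat_power)
    also have "\<dots> \<le> (2 * R + 1) ^ CARD('d)"
      using R of_int_floor_le[of R] by (intro power_mono) auto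
    finally show ?thesis
      using finite_imageD[OF finite_subset[OF sub fin] inj] by blast
  qed
  then show "finite T" and "real (card T) \<le> (2 * R + 1) ^ CARD('d)" by auto
qed

text \<open>The interval is a union of 2B complete residue systems modulo K, indexed by the
  quotient.\<close>

lemma sum_int_mod_periods:
  fixes \<phi> :: "int \<Rightarrow> real"
  assumes "K > 0"
  shows "(\<Sum>u\<in>{- (int K * int B)..<int K * int B}. \<phi> (u mod int K)) = 2 * real B * (\<Sum>r<K. \<phi> (int r))"
proof -
  have "(\<Sum>u\<in>{- (int K * int B)..<int K * int B}. \<phi> (u mod int K)) =
      (\<Sum>(s, r)\<in>{- int B..<int B} \<times> {..<K}. \<phi> (int r))"
  proof (rule sum.reindex_bij_witness[of _ "\<lambda>(s, r). int K * s + int r" "\<lambda>u. (u div int K, nat (u mod int K))"])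
    fix u assume u: "u \<in> {- (int K * int B)..<int K * int B}"
    have "- (int K * int B) div int K \<le> u div int K"
      using u assms by (intro zdiv_mono1) auto
    then have "- int B \<le> u div int K"
      using assms by (simp flip: mult_minus_right)
    moreover have "u div int K < int B"
    proof -
      have "int K * (u div int K) \<le> u"
        using assms by (simp add: mult.commute[of "int K"] minus_mod_eq_div_mult[symmetric])
      then have "int K * (u div int K) < int K * int B" using u by auto
      then show ?thesis using assms by simp
    qed
    ultimately show "(u div int K, nat (u mod int K)) \<in> {- int B..<int B} \<times> {..<K}"
      using assms by (auto simp: nat_less_iff)
  next
    fix p assume "p \<in> {- int B..<int B} \<times> {..<K}"
    then obtain s r where p: "p = (s, r)" "- int B \<le> s" "s + 1 \<le> int B" "r < K" by auto
    have "int K * - int B \<le> int K * s" "int K * (s + 1) \<le> int K * int B"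
      using p by (intro mult_left_mono; simp)+
    then show "(case p of (s, r) \<Rightarrow> int K * s + int r) \<in> {- (int K * int B)..<int K * int B}"
      using p by (simp add: algebra_simps)
  qed (use assms in auto)
  also have "\<dots> = 2 * real B * (\<Sum>r<K. \<phi> (int r))"
    by (subst sum.cartesian_product[symmetric]) simp
  finally show ?thesis .
qed

lemma sum_recip_both_ends:
  "(\<Sum>r<K. 1 / real (Suc r) + 1 / real (K - r)) = 2 * harm K"
proof -
  have "(\<Sum>r<K. 1 / real (K - r)) = (\<Sum>r<K. 1 / real (Suc (K - Suc r)))"
    by (intro sum.cong) (auto simp: Suc_diff_Suc)
  also have "\<dots> = (\<Sum>r<K. 1 / real (Suc r))" by (rule sum.nat_diff_reindex)
  finally show ?thesis by (simp add: sum.distrib harm_altdef inverse_eq_divide)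
qed

text \<open>Group the t by the cell of K z(t): the geometric bound depends on the cell alone, and
  each cell holds at most \<open>N\<close> indices. Per coordinate there are 2B periods, each
  contributing 4 K \<open>harm K\<close>, whence the constant 8.\<close>

lemma sum_prod_geometric_cis_bound:
  fixes z :: "'t \<Rightarrow> 'i :: finite \<Rightarrow> real"
  assumes T: "finite T" and K: "K > 0" and B: "\<And>t i. t \<in> T \<Longrightarrow> \<bar>z t i\<bar> < real B"
    and N: "\<And>u. real (card {t \<in> T. \<forall>i. \<lfloor>K * z t i\<rfloor> = u i}) \<le> N"
  shows "(\<Sum>t\<in>T. \<Prod>i\<in>UNIV. norm (\<Sum>k<K. cis (2 * pi * (z t i * real k))))
     \<le> N * (8 * real B * real K * harm K) ^ CARD('i)"
proof -
  define W where "W = (\<lambda>r. 2 * real K * (1 / real (Suc (nat r)) + 1 / real (K - nat r)))"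
  define V where "V = (\<lambda>u :: 'i \<Rightarrow> int. \<Prod>i\<in>UNIV. W (u i mod int K))"
  define cell where "cell = (\<lambda>t i. \<lfloor>K * z t i\<rfloor>)"
  let ?R = "{- (int K * int B)..<int K * int B}"
  have W: "W r \<ge> 0" for r by (simp add: W_def)
  then have V: "V u \<ge> 0" for u by (simp add: V_def prod_nonneg)
  have "N \<ge> 0" using N order_trans[OF of_nat_0_le_iff] by blast
  have sub: "cell ` T \<subseteq> PiE UNIV (\<lambda>_. ?R)"
  proof (intro image_subsetI PiE_I)
    fix t i assume "t \<in> T"
    then have "\<bar>K * z t i\<bar> < K * real B"
      using B[of t i] K by (simp add: abs_mult)
    then have "- (real K * real B) \<le> K * z t i" "K * z t i < real K * real B" by auto
    then show "cell t i \<in> ?R"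
      by (auto simp: cell_def le_floor_iff floor_less_iff)
  qed auto
  have "(\<Sum>t\<in>T. \<Prod>i\<in>UNIV. norm (\<Sum>k<K. cis (2 * pi * (z t i * real k)))) \<le> (\<Sum>t\<in>T. V (cell t))"
    unfolding V_def W_def cell_def by (intro sum_mono prod_mono conjI norm_ge_zero geometric_cis_bound[OF K])
  also have "\<dots> = (\<Sum>u\<in>cell ` T. \<Sum>t\<in>{t \<in> T. cell t = u}. V (cell t))"
    by (rule sum.image_gen[OF T])
  also have "\<dots> = (\<Sum>u\<in>cell ` T. real (card {t \<in> T. cell t = u}) * V u)"
    by (intro sum.cong refl) simp
  also have "\<dots> \<le> (\<Sum>u\<in>cell ` T. N * V u)"
    using N V by (intro sum_mono mult_right_mono) (auto simp: cell_def fun_eq_iff)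
  \<comment> \<open>Admitting also the unoccupied cells makes the index set a product, over which
    the sum factors.\<close>
  also have "\<dots> \<le> (\<Sum>u\<in>PiE UNIV (\<lambda>_. ?R). N * V u)"
    using V \<open>N \<ge> 0\<close> by (intro sum_mono2 sub finite_PiE) auto
  also have "\<dots> = N * (\<Prod>i\<in>(UNIV :: 'i set). \<Sum>u\<in>?R. W (u mod int K))"
    by (subst prod_sum_PiE) (auto simp: V_def sum_distrib_left)
  also have "(\<Sum>u\<in>?R. W (u mod int K)) = 8 * real B * real K * harm K"
  proof -
    have "(\<Sum>r<K. W (int r)) = 2 * real K * (2 * harm K)"
      unfolding W_def nat_int sum_distrib_left[symmetric] sum_recip_both_ends ..
    then show ?thesis by (simp add: sum_int_mod_periods[OF K])
  qed
  finally show ?thesis by simp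
qed

section \<open>Counting near points box by box\<close>

text \<open>Floor division makes every box a translate of {0..<K}^d, also at negative coordinates;
  the remainders are then the positions inside the box.\<close>

definition int_box :: "nat \<Rightarrow> int ^ 'd \<Rightarrow> int ^ 'd"
  where "int_box K a = (\<chi> i. a $ i div int K)"

lemma shifted_point_nth: "shifted_point q l a $ i = (of_int (a $ i) + l $ i) / real q"
  by (simp add: shifted_point_def)

lemma int_div_diff_bound:
  assumes "K > 0"
  shows "\<bar>real_of_int (a div int K - a' div int K)\<bar> \<le> \<bar>real_of_int (a - a')\<bar> / K + 1"
proof -
  have "a div int K = \<lfloor>a / real K\<rfloor>" "a' div int K = \<lfloor>a' / real K\<rfloor>"
    using floor_divide_of_int_eq[where ?'a = real, of _ "int K"] by simp_all
  moreover have "\<bar>real_of_int (a - a')\<bar> / K = \<bar>a / real K - a' / real K\<bar>"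
    using assms by (simp flip: diff_divide_distrib)
  ultimately show ?thesis by linarith
qed

lemma int_mod_diff_bound:
  assumes "K > 0" "a div int K = a' div int K"
  shows "real (nat (a mod int K)) - real (nat (a' mod int K)) = a - a'"
    and "\<bar>real_of_int (a - a')\<bar> \<le> K"
proof -
  have "a - a' = a mod int K - a' mod int K"
    using assms(2) by (metis add_diff_cancel_left mult_div_mod_eq)
  moreover have "0 \<le> a mod int K" "0 \<le> a' mod int K" "a mod int K < K" "a' mod int K < K"
    using assms by auto
  ultimately show "real (nat (a mod int K)) - real (nat (a' mod int K)) = a - a'"
    and "\<bar>real_of_int (a - a')\<bar> \<le> K"
    by linarith+
qed

text \<open>Any two such a differ by at most q in each coordinate. This trivial count gives
  finiteness and settles the range q psi(q) < 1.\<close>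

lemma shifted_points_in_cube:
  fixes l :: "real ^ 'd"
  assumes "q > 0"
  shows "finite {a. shifted_point q l a \<in> unit_cube}"
    and "real (card {a. shifted_point q l a \<in> unit_cube}) \<le> (3 * real q) ^ CARD('d)"
proof -
  have diff: "\<bar>real_of_int (a $ i - a' $ i)\<bar> \<le> real q"
    if "a \<in> {a. shifted_point q l a \<in> unit_cube}" "a' \<in> {a. shifted_point q l a \<in> unit_cube}" for a a' i
  proof -
    have "0 \<le> a $ i + l $ i" "a $ i + l $ i \<le> q" "0 \<le> a' $ i + l $ i" "a' $ i + l $ i \<le> q"
      using that assms by (auto simp: mem_unit_cube shifted_point_nth field_simps)
    then show ?thesis by simp
  qed
  show "finite {a. shifted_point q l a \<in> unit_cube}"
    using card_int_vec_bounded(1)[OF of_nat_0_le_iff diff] by blast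
  have "real (card {a. shifted_point q l a \<in> unit_cube}) \<le> (2 * real q + 1) ^ CARD('d)"
    using card_int_vec_bounded(2)[OF of_nat_0_le_iff diff] by blast
  also have "\<dots> \<le> (3 * real q) ^ CARD('d)"
    using assms by (intro power_mono) auto
  finally show "real (card {a. shifted_point q l a \<in> unit_cube}) \<le> (3 * real q) ^ CARD('d)" .
qed

text \<open>Converts closeness of representatives into a count of boxes: a distance
  \<open>\<rho>\<close> in the cube is q \<open>\<rho>\<close> in the lattice, so box indices differ
  by at most q \<open>\<rho>\<close> / K + 1, the 1 coming from the floors.\<close>

lemma card_boxes_bounded:
  fixes rep :: "int ^ 'd \<Rightarrow> int ^ 'd"
  assumes "q > 0" "K > 0" "\<rho> \<ge> 0" and rep: "\<And>m. m \<in> T \<Longrightarrow> int_box K (rep m) = m"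
    and near: "\<And>m m' i. m \<in> T \<Longrightarrow> m' \<in> T \<Longrightarrow>
      \<bar>shifted_point q l (rep m) $ i - shifted_point q l (rep m') $ i\<bar> \<le> \<rho>"
  shows "finite T" and "real (card T) \<le> (2 * (real q * \<rho> / real K) + 3) ^ CARD('d)"
proof -
  let ?R = "real q * \<rho> / real K + 1"
  have diff: "\<bar>real_of_int (m $ i - m' $ i)\<bar> \<le> ?R" if "m \<in> T" "m' \<in> T" for m m' i
  proof -
    have "\<bar>real_of_int (rep m $ i - rep m' $ i)\<bar> / q \<le> \<rho>"
      using near[OF that, of i] assms(1)
      by (simp add: shifted_point_nth flip: diff_divide_distrib)
    then have "\<bar>real_of_int (rep m $ i - rep m' $ i)\<bar> / K \<le> q * \<rho> / K"
      using assms by (intro divide_right_mono) (auto simp: field_simps)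
    moreover have "m $ i = rep m $ i div int K" "m' $ i = rep m' $ i div int K"
      using rep that by (metis int_box_def vec_lambda_beta)+
    ultimately show ?thesis
      using int_div_diff_bound[OF assms(2), of "rep m $ i" "rep m' $ i"] by simp
  qed
  have "?R \<ge> 0" using assms by simp
  from card_int_vec_bounded[OF this diff]
  show "finite T" and "real (card T) \<le> (2 * (real q * \<rho> / real K) + 3) ^ CARD('d)"
    by (auto simp: algebra_simps)
qed

text \<open>Here \<open>g\<close> stands for the gradient of \<open>f\<close>, and \<open>1 / P\<close> for the scale below which it is injective.\<close>

locale curved_graph =
  fixes f :: "real ^ 'd \<Rightarrow> real" and g :: "'d \<Rightarrow> real ^ 'd \<Rightarrow> real" and L c :: real and M P :: nat
  assumes linearization: "\<And>x x'. x \<in> unit_cube \<Longrightarrow> x' \<in> unit_cube \<Longrightarrow>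
      \<bar>f x - f x' - (\<Sum>i\<in>UNIV. g i x' * (x $ i - x' $ i))\<bar> \<le> L * (\<Sum>i\<in>UNIV. \<bar>x $ i - x' $ i\<bar>)\<^sup>2"
    and L_nonneg: "L \<ge> 0" and c_pos: "c > 0" and P_pos: "P > 0"
    and gradient_bound: "\<And>x i. x \<in> unit_cube \<Longrightarrow> \<bar>g i x\<bar> < real M"
    and gradient_separates: "\<And>x x' s i. x \<in> unit_cube \<Longrightarrow> x' \<in> unit_cube \<Longrightarrow>
      (\<And>i. \<bar>x $ i - x' $ i\<bar> \<le> 1 / real P) \<Longrightarrow> (\<And>j. \<bar>g j x - g j x'\<bar> \<le> s) \<Longrightarrow> c * \<bar>x $ i - x' $ i\<bar> \<le> s"
begin

text \<open>Sharing a cell forces two gradients to within 1/(K|j|), hence two points to within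
  1/(cK|j|), provided they already lie within 1/P of each other. The grid of mesh 1/P secures this
  proviso at the price of the first factor.\<close>

lemma gradient_cell_card:
  fixes rep :: "int ^ 'd \<Rightarrow> int ^ 'd" and j :: real
  assumes "q > 0" "K > 0" "j \<noteq> 0" and T: "finite T"
    and rep: "\<And>m. m \<in> T \<Longrightarrow> int_box K (rep m) = m"
      "\<And>m. m \<in> T \<Longrightarrow> shifted_point q l (rep m) \<in> unit_cube"
  shows "real (card {m \<in> T. \<forall>i. \<lfloor>real K * (j * g i (shifted_point q l (rep m)))\<rfloor> = u i})
     \<le> (real P + 1) ^ CARD('d) * (2 * (real q / (c * \<bar>j\<bar> * (real K)\<^sup>2)) + 3) ^ CARD('d)"
proof -
  define x where "x = (\<lambda>m. shifted_point q l (rep m))"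
  define F where "F = {m \<in> T. \<forall>i. \<lfloor>real K * (j * g i (x m))\<rfloor> = u i}"
  define G where "G = (\<lambda>p. {m \<in> F. \<forall>i. \<lfloor>real P * x m $ i\<rfloor> = p i})"
  \<comment> \<open>The index P occurs for coordinates equal to 1, so there are P + 1 values per
    coordinate.\<close>
  let ?Q = "PiE UNIV (\<lambda>_ :: 'd. {0..int P})"
  let ?b = "(2 * (real q / (c * \<bar>j\<bar> * (real K)\<^sup>2)) + 3) ^ CARD('d)"
  have close: "\<bar>s - t\<bar> \<le> 1 / \<bar>k\<bar>" if "\<lfloor>k * s\<rfloor> = \<lfloor>k * t\<rfloor>" "k \<noteq> 0" for k s t :: real
  proof -
    have "\<bar>k * s - k * t\<bar> \<le> 1" using that(1) by linarith
    then have "\<bar>k\<bar> * \<bar>s - t\<bar> \<le> 1" by (simp add: abs_mult flip: right_diff_distrib)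
    then show ?thesis using that(2) by (simp add: field_simps)
  qed
  have G: "real (card (G p)) \<le> ?b" for p
  proof -
    have "real (card (G p)) \<le> (2 * (real q * (1 / (c * \<bar>j\<bar> * real K)) / real K) + 3) ^ CARD('d)"
    proof (rule card_boxes_bounded(2)[OF assms(1,2), of _ _ rep l])
      fix m m' i assume m: "m \<in> G p" "m' \<in> G p"
      have "c * \<bar>x m $ i - x m' $ i\<bar> \<le> 1 / \<bar>real K * j\<bar>"
      proof (rule gradient_separates)
        show "x m \<in> unit_cube" "x m' \<in> unit_cube" using m rep by (auto simp: G_def F_def x_def)
        show "\<bar>x m $ k - x m' $ k\<bar> \<le> 1 / real P" for k
          using close[of "real P" "x m $ k" "x m' $ k"] m P_pos by (auto simp: G_def)
        show "\<bar>g k (x m) - g k (x m')\<bar> \<le> 1 / \<bar>real K * j\<bar>" for k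
          using m assms by (intro close) (auto simp: G_def F_def mult.assoc)
      qed
      then show "\<bar>shifted_point q l (rep m) $ i - shifted_point q l (rep m') $ i\<bar> \<le> 1 / (c * \<bar>j\<bar> * real K)"
        using c_pos assms by (simp add: x_def field_simps abs_mult)
    qed (use c_pos rep in \<open>auto simp: G_def F_def\<close>)
    then show ?thesis by (simp add: power2_eq_square mult.assoc)
  qed
  have "F \<subseteq> (\<Union>p\<in>?Q. G p)"
  proof
    fix m assume m: "m \<in> F"
    have "\<lfloor>real P * x m $ i\<rfloor> \<in> {0..int P}" for i
    proof -
      have "0 \<le> x m $ i" "x m $ i \<le> 1" using m rep(2) by (auto simp: F_def x_def mem_unit_cube)
      then have "0 \<le> real P * x m $ i" "real P * x m $ i \<le> real P"
        by (auto intro: mult_left_le)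
      then show ?thesis by (simp add: floor_le_iff)
    qed
    then have "(\<lambda>i. \<lfloor>real P * x m $ i\<rfloor>) \<in> ?Q" by auto
    then show "m \<in> (\<Union>p\<in>?Q. G p)" using m by (auto simp: G_def)
  qed
  moreover have finQ: "finite ?Q" by (intro finite_PiE) auto
  moreover have "finite (G p)" for p using T by (auto simp: G_def F_def)
  ultimately have "card F \<le> (\<Sum>p\<in>?Q. card (G p))"
    by (intro order_trans[OF card_mono card_UN_le]) auto
  then have "real (card F) \<le> (\<Sum>p\<in>?Q. real (card (G p)))"
    by (metis of_nat_le_iff of_nat_sum)
  also have "\<dots> \<le> (\<Sum>p\<in>?Q. ?b)" by (intro sum_mono G)
  also have "\<dots> = (real P + 1) ^ CARD('d) * ?b"
    by (simp add: card_PiE nat_add_distrib add.commute)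
  finally show ?thesis by (simp add: F_def x_def)
qed

text \<open>Linearizing at \<open>a0\<close> makes qf affine in the position inside the box. The
  factor q cancels the spacing 1/q, so the frequencies are the gradient components themselves, and
  the remainder is L (dK)^2 / q.\<close>

lemma near_count_in_box:
  fixes l :: "real ^ 'd"
  assumes q: "q > 0" and K: "K > 0" and H: "H > 0"
    and small: "6 * (real H - 1) * (r + L * (real CARD('d) * real K)\<^sup>2 / real q) \<le> 1"
    and N: "N \<subseteq> {a. int_box K a = m \<and> shifted_point q l a \<in> unit_cube \<and>
        (\<exists>b. \<bar>real q * f (shifted_point q l a) - \<gamma> - of_int b\<bar> < r)}"
    and a0: "int_box K a0 = m" "shifted_point q l a0 \<in> unit_cube"
  shows "(real H)\<^sup>2 * real (card N) \<le> 4 * (\<Sum>h<H. \<Sum>h'<H. \<Prod>i\<in>UNIV.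
     norm (\<Sum>k<K. cis (2 * pi * ((real h - real h') * g i (shifted_point q l a0) * real k))))"
proof -
  define x where "x = shifted_point q l"
  define k where "k = (\<lambda>(a :: int ^ 'd) i. nat (a $ i mod int K))"
  define y where "y = (\<lambda>i. g i (x a0))"
  \<comment> \<open>Constant term of the affine model when positions are remainders modulo K rather
    than offsets from \<open>a0\<close>.\<close>
  define c0 where "c0 = real q * f (x a0) - \<gamma> - (\<Sum>i\<in>UNIV. y i * real (k a0 i))"
  have div: "a $ i div int K = a0 $ i div int K" if "a \<in> N" for a i
    using that N a0(1) unfolding int_box_def vec_eq_iff by auto
  have inj: "inj_on k N"
  proof
    fix a a' assume a: "a \<in> N" "a' \<in> N" "k a = k a'"
    have "a $ i = a' $ i" for i
      using int_mod_diff_bound(1)[OF K, of "a $ i" "a' $ i"] div[OF a(1), of i] div[OF a(2), of i]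
        fun_cong[OF a(3), of i]
      by (simp add: k_def del: eq_nat_nat_iff)
    then show "a = a'" by (simp add: vec_eq_iff)
  qed
  have "(real H)\<^sup>2 * real (card (k ` N)) \<le> 4 * (\<Sum>h<H. \<Sum>h'<H. \<Prod>i\<in>UNIV.
     norm (\<Sum>k<K. cis (2 * pi * ((real h - real h') * y i * real k))))"
  proof (rule box_count[where c = c0])
    show "k ` N \<subseteq> PiE UNIV (\<lambda>_. {..<K})" using K by (auto simp: k_def nat_less_iff)
    fix k' assume "k' \<in> k ` N"
    then obtain a where a: "a \<in> N" and k': "k' = k a" by blast
    have xa: "x a \<in> unit_cube" using a N by (auto simp: x_def)
    obtain b where b: "\<bar>real q * f (x a) - \<gamma> - of_int b\<bar> < r" using a N by (auto simp: x_def)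
    have step: "x a $ i - x a0 $ i = real_of_int (a $ i - a0 $ i) / q" for i
      by (simp add: x_def shifted_point_nth flip: diff_divide_distrib)
    have "c0 + (\<Sum>i\<in>UNIV. y i * real (k a i)) =
        real q * f (x a0) - \<gamma> + (\<Sum>i\<in>UNIV. y i * (real (k a i) - real (k a0 i)))"
      by (simp add: c0_def right_diff_distrib sum_subtractf)
    also have "\<dots> = real q * f (x a0) - \<gamma> + real q * (\<Sum>i\<in>UNIV. y i * (x a $ i - x a0 $ i))"
      using int_mod_diff_bound(1)[OF K div[OF a]] q
      by (simp add: k_def step sum_distrib_left)
    finally have eq: "c0 + (\<Sum>i\<in>UNIV. y i * real (k a i)) - b =
        (real q * f (x a) - \<gamma> - b) - real q * (f (x a) - f (x a0) - (\<Sum>i\<in>UNIV. y i * (x a $ i - x a0 $ i)))"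
      by (simp add: algebra_simps)
    have "\<bar>x a $ i - x a0 $ i\<bar> \<le> real K / q" for i
      using int_mod_diff_bound(2)[OF K div[OF a], of i] q
      unfolding step by (simp add: divide_right_mono)
    then have "(\<Sum>i\<in>UNIV. \<bar>x a $ i - x a0 $ i\<bar>) \<le> (\<Sum>i\<in>(UNIV :: 'd set). real K / q)"
      by (rule sum_mono)
    then have "L * (\<Sum>i\<in>UNIV. \<bar>x a $ i - x a0 $ i\<bar>)\<^sup>2 \<le> L * (real CARD('d) * (real K / q))\<^sup>2"
      using L_nonneg by (intro mult_left_mono power_mono) (auto intro: sum_nonneg)
    then have "\<bar>f (x a) - f (x a0) - (\<Sum>i\<in>UNIV. y i * (x a $ i - x a0 $ i))\<bar>
        \<le> L * (real CARD('d) * (real K / q))\<^sup>2"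
      using linearization[OF xa, of "x a0"] a0(2) by (simp add: x_def y_def)
    then have "real q * \<bar>f (x a) - f (x a0) - (\<Sum>i\<in>UNIV. y i * (x a $ i - x a0 $ i))\<bar>
        \<le> real q * (L * (real CARD('d) * (real K / q))\<^sup>2)"
      by (intro mult_left_mono) auto
    also have "\<dots> = L * (real CARD('d) * real K)\<^sup>2 / real q"
      using q by (simp add: power2_eq_square)
    finally have "\<bar>real q * (f (x a) - f (x a0) - (\<Sum>i\<in>UNIV. y i * (x a $ i - x a0 $ i)))\<bar>
        \<le> L * (real CARD('d) * real K)\<^sup>2 / real q"
      by (simp add: abs_mult)
    then have "\<bar>c0 + (\<Sum>i\<in>UNIV. y i * real (k a i)) - b\<bar> \<le> r + L * (real CARD('d) * real K)\<^sup>2 / real q"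
      unfolding eq using b by linarith
    then have "6 * (real H - 1) * \<bar>c0 + (\<Sum>i\<in>UNIV. y i * real (k a i)) - b\<bar>
        \<le> 6 * (real H - 1) * (r + L * (real CARD('d) * real K)\<^sup>2 / real q)"
      using H by (intro mult_left_mono) auto
    then show "\<exists>b. 6 * (real H - 1) * \<bar>c0 + (\<Sum>i\<in>UNIV. y i * real (k' i)) - real_of_int b\<bar> \<le> 1"
      using small k' by (intro exI[of _ b]) simp
  qed
  then show ?thesis by (simp add: card_image[OF inj] y_def x_def)
qed

text \<open>The |j| M periods met by j times the gradient supply a factor |j|, which multiplies the
  cell count 2q/(c|j|K^2) + 3 to 2q/(cK^2) + 3|j|; only here does |j| <= H enter.\<close>

lemma sum_boxes_bound:
  fixes l :: "real ^ 'd" and rep :: "int ^ 'd \<Rightarrow> int ^ 'd" and j :: int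
  assumes q: "q > 0" and K: "K > 0" and j: "j \<noteq> 0" "\<bar>j\<bar> \<le> int H" and T: "finite T"
    and rep: "\<And>m. m \<in> T \<Longrightarrow> int_box K (rep m) = m"
      "\<And>m. m \<in> T \<Longrightarrow> shifted_point q l (rep m) \<in> unit_cube"
  shows "(\<Sum>m\<in>T. \<Prod>i\<in>UNIV. norm (\<Sum>k<K. cis (2 * pi * (of_int j * g i (shifted_point q l (rep m)) * real k))))
     \<le> (real P + 1) ^ CARD('d) *
       (8 * real M * real K * harm K * (2 * (real q / (c * (real K)\<^sup>2)) + 3 * real H)) ^ CARD('d)"
proof -
  let ?J = "real (nat \<bar>j\<bar>)"
  have J: "?J = \<bar>real_of_int j\<bar>" "?J > 0" using j by auto
  have "(\<Sum>m\<in>T. \<Prod>i\<in>UNIV. norm (\<Sum>k<K. cis (2 * pi * (of_int j * g i (shifted_point q l (rep m)) * real k))))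
     \<le> ((real P + 1) ^ CARD('d) * (2 * (real q / (c * \<bar>real_of_int j\<bar> * (real K)\<^sup>2)) + 3) ^ CARD('d))
       * (8 * real (nat \<bar>j\<bar> * M) * real K * harm K) ^ CARD('d)"
  proof (rule sum_prod_geometric_cis_bound[OF T K])
    fix m i assume m: "m \<in> T"
    then show "\<bar>of_int j * g i (shifted_point q l (rep m))\<bar> < real (nat \<bar>j\<bar> * M)"
      using gradient_bound[OF rep(2)[OF m], of i] J by (simp add: abs_mult)
  next
    fix u
    show "real (card {m \<in> T. \<forall>i. \<lfloor>real K * (of_int j * g i (shifted_point q l (rep m)))\<rfloor> = u i})
      \<le> (real P + 1) ^ CARD('d) * (2 * (real q / (c * \<bar>real_of_int j\<bar> * (real K)\<^sup>2)) + 3) ^ CARD('d)"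
      using j by (intro gradient_cell_card[OF q K _ T rep]) auto
  qed
  also have "\<dots> = (real P + 1) ^ CARD('d) *
      (8 * real M * real K * harm K * (2 * (real q / (c * (real K)\<^sup>2)) + 3 * ?J)) ^ CARD('d)"
  proof -
    let ?b = "2 * (real q / (c * \<bar>real_of_int j\<bar> * (real K)\<^sup>2)) + 3"
    have "?b * (8 * real (nat \<bar>j\<bar> * M) * real K * harm K) = 8 * real M * real K * harm K * (?b * ?J)"
      by (simp only: of_nat_mult mult_ac)
    also have "?b * ?J = 2 * (real q / (c * (real K)\<^sup>2)) + 3 * ?J"
      using J c_pos K by (simp add: field_simps)
    finally have "?b * (8 * real (nat \<bar>j\<bar> * M) * real K * harm K) =
        8 * real M * real K * harm K * (2 * (real q / (c * (real K)\<^sup>2)) + 3 * ?J)" .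
    then show ?thesis by (simp only: mult.assoc power_mult_distrib[symmetric])
  qed
  also have "\<dots> \<le> (real P + 1) ^ CARD('d) *
      (8 * real M * real K * harm K * (2 * (real q / (c * (real K)\<^sup>2)) + 3 * real H)) ^ CARD('d)"
    using j c_pos by (intro mult_left_mono power_mono) (auto simp: harm_nonneg)
  finally show ?thesis .
qed

text \<open>Among the H^2 pairs of frequencies, the H diagonal ones have the trivial product K^d in
  every box, and each of the others is bounded by \<open>?D\<close>. Dividing by H^2 leaves
  \<open>?A / H + ?D\<close>.\<close>

lemma near_count_bound:
  fixes l :: "real ^ 'd"
  assumes q: "q > 0" and K: "K > 0" "K \<le> q" and H: "H > 0"
    and small: "6 * (real H - 1) * (r + L * (real CARD('d) * real K)\<^sup>2 / real q) \<le> 1"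
  shows "real (card {a. shifted_point q l a \<in> unit_cube \<and>
        (\<exists>b. \<bar>real q * f (shifted_point q l a) - \<gamma> - of_int b\<bar> < r)})
     \<le> 4 * ((5 * real q) ^ CARD('d) / real H + (real P + 1) ^ CARD('d) *
         (8 * real M * real K * harm K * (2 * (real q / (c * (real K)\<^sup>2)) + 3 * real H)) ^ CARD('d))"
    (is "real (card ?N) \<le> 4 * (?A / real H + ?D)")
proof -
  define E where "E = {a. shifted_point q l a \<in> unit_cube}"
  define T where "T = int_box K ` E"
  \<comment> \<open>Representatives are chosen inside \<open>E\<close>, since the gradient and the
    Taylor bound are controlled only on the cube.\<close>
  define rep where "rep = inv_into E (int_box K)"
  have finE: "finite E" unfolding E_def by (rule shifted_points_in_cube[OF q])
  have NE: "?N \<subseteq> E" by (auto simp: E_def)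
  have finN: "finite ?N" using NE finE by (rule finite_subset)
  have finT: "finite T" using finE by (simp add: T_def)
  have rep: "int_box K (rep m) = m" "shifted_point q l (rep m) \<in> unit_cube" if "m \<in> T" for m
    using that inv_into_into[of m "int_box K" E] f_inv_into_f[of m "int_box K" E]
    by (auto simp: T_def rep_def E_def)
  have "real (card T) \<le> (2 * (real q * 1 / real K) + 3) ^ CARD('d)"
  proof (rule card_boxes_bounded(2)[OF q K(1), of _ _ rep l])
    fix m m' i assume "m \<in> T" "m' \<in> T"
    then have "shifted_point q l (rep m) \<in> unit_cube" "shifted_point q l (rep m') \<in> unit_cube"
      by (auto intro: rep)
    then have "0 \<le> shifted_point q l (rep m) $ i" "shifted_point q l (rep m) $ i \<le> 1"
      "0 \<le> shifted_point q l (rep m') $ i" "shifted_point q l (rep m') $ i \<le> 1"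
      unfolding mem_unit_cube by auto
    then show "\<bar>shifted_point q l (rep m) $ i - shifted_point q l (rep m') $ i\<bar> \<le> 1" by linarith
  qed (auto intro: rep)
  then have "real (card T) * real K ^ CARD('d) \<le> (2 * (real q * 1 / real K) + 3) ^ CARD('d) * real K ^ CARD('d)"
    by (intro mult_right_mono) auto
  also have "\<dots> = (2 * real q + 3 * real K) ^ CARD('d)"
    using K by (simp add: power_mult_distrib[symmetric] distrib_right)
  \<comment> \<open>Boundary boxes account for 3K, which K <= q absorbs.\<close>
  also have "\<dots> \<le> ?A" using K by (intro power_mono) auto
  finally have diag: "real (card T) * real K ^ CARD('d) \<le> ?A" .
  have D: "?D \<ge> 0" using c_pos by (simp add: harm_nonneg)
  let ?p = "\<lambda>h h' m. \<Prod>i\<in>UNIV. norm (\<Sum>k<K. cis (2 * pi *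
    ((real h - real h') * g i (shifted_point q l (rep m)) * real k)))"
  \<comment> \<open>Granting \<open>?D\<close> to the diagonal pairs as well avoids counting the
    off-diagonal ones.\<close>
  have pair: "(\<Sum>m\<in>T. ?p h h' m) \<le> (if h = h' then ?A else 0) + ?D" if "h < H" "h' < H" for h h'
  proof (cases "h = h'")
    case True
    then show ?thesis using diag D by simp
  next
    case False
    then show ?thesis
      using sum_boxes_bound[OF q K(1) _ _ finT rep, of "int h - int h'" H] that by simp
  qed
  have "real (card ?N) = (\<Sum>a\<in>?N. 1)" by simp
  also have "\<dots> = (\<Sum>m\<in>T. \<Sum>a\<in>{a \<in> ?N. int_box K a = m}. 1)"
    using NE by (intro sum.group[symmetric] finN finT) (auto simp: T_def)
  finally have "(real H)\<^sup>2 * real (card ?N) = (\<Sum>m\<in>T. (real H)\<^sup>2 * real (card {a \<in> ?N. int_box K a = m}))"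
    by (simp add: sum_distrib_left)
  also have "\<dots> \<le> (\<Sum>m\<in>T. 4 * (\<Sum>h<H. \<Sum>h'<H. ?p h h' m))"
    by (intro sum_mono near_count_in_box[OF q K(1) H small _ rep(1) rep(2), where \<gamma> = \<gamma>]) auto
  also have "\<dots> = 4 * (\<Sum>h<H. \<Sum>h'<H. \<Sum>m\<in>T. ?p h h' m)"
    unfolding sum_distrib_left[symmetric]
    by (rule arg_cong[where f = "(*) 4"], subst sum.swap, rule sum.cong[OF refl], rule sum.swap)
  also have "\<dots> \<le> 4 * (\<Sum>h<H. \<Sum>h'<H. (if h = h' then ?A else 0) + ?D)"
    using pair by (intro mult_left_mono sum_mono) auto
  also have "\<dots> = 4 * (real H * ?A + (real H)\<^sup>2 * ?D)"
    by (simp add: sum.distrib power2_eq_square distrib_left)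
  also have "\<dots> = (real H)\<^sup>2 * (4 * (?A / real H + ?D))"
    using H by (simp add: power2_eq_square field_simps)
  finally show ?thesis using H by simp
qed

end

section \<open>Choice of the parameters and the final constant\<close>

lemma harm_le_ln: "n > 0 \<Longrightarrow> harm n \<le> 1 + ln (real n)"
  \<comment> \<open>The difference of \<open>harm n\<close> and \<open>ln n\<close> decreases and
    equals 1 at n = 1, which is index 0 here.\<close>
  using decseqD[OF decseq_harm_diff_ln, of 0 "n - 1"] by (simp add: harm_expand)

lemma powr_neg_half_nat:
  assumes "x > 0"
  shows "x powr (- real n / 2) = (1 / sqrt x) ^ n"
proof -
  have "x powr (- real n / 2) = (x powr (- 1 / 2)) powr real n"
    by (simp add: powr_powr)
  also have "x powr (- 1 / 2) = 1 / sqrt x"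
    using assms by (simp add: powr_minus_divide powr_half_sqrt)
  finally show ?thesis using assms by (simp add: powr_realpow)
qed

context curved_graph
begin

text \<open>One summand per source: the trivial count for q psi(q) < 1; the diagonal, with 24 = 4 *
  6 from \<open>box_count\<close> and the phase condition; the off-diagonal pairs, where 16 = 8 * 2
  includes the bound for \<open>harm K\<close> and 8/c the loss of 4 from rounding
  \<open>K\<close>.\<close>

definition count_const :: real where
  "count_const = 3 ^ CARD('d) + 24 * (1 + L * (real CARD('d))\<^sup>2) * 5 ^ CARD('d) +
     4 * (real P + 1) ^ CARD('d) * (16 * real M * (8 / c + 3)) ^ CARD('d)"

lemma count_const_ge:
  shows "3 ^ CARD('d) \<le> count_const"
    and "24 * (1 + L * (real CARD('d))\<^sup>2) * 5 ^ CARD('d) \<le> count_const"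
    and "4 * (real P + 1) ^ CARD('d) * (16 * real M * (8 / c + 3)) ^ CARD('d) \<le> count_const"
    and "count_const > 0"
proof -
  have "0 < (3 :: real) ^ CARD('d)" "0 \<le> 24 * (1 + L * (real CARD('d))\<^sup>2) * 5 ^ CARD('d)"
    "0 \<le> 4 * (real P + 1) ^ CARD('d) * (16 * real M * (8 / c + 3)) ^ CARD('d)"
    using L_nonneg c_pos by auto
  then show "3 ^ CARD('d) \<le> count_const"
    and "24 * (1 + L * (real CARD('d))\<^sup>2) * 5 ^ CARD('d) \<le> count_const"
    and "4 * (real P + 1) ^ CARD('d) * (16 * real M * (8 / c + 3)) ^ CARD('d) \<le> count_const"
    and "count_const > 0"
    unfolding count_const_def by linarith+
qed

text \<open>The range in which K is at least 1. Both parameters of \<open>near_count_bound\<close>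
  are rounded to integers; qr >= 1 and r <= 1/2 make this cost only constant factors.\<close>

lemma near_count_bound_large:
  fixes l :: "real ^ 'd"
  assumes q: "q > 0" and r: "0 < r" "r \<le> 1 / 2" and qr: "1 \<le> real q * r"
  shows "real (card {a. shifted_point q l a \<in> unit_cube \<and>
        (\<exists>b. \<bar>real q * f (shifted_point q l a) - \<gamma> - of_int b\<bar> < r)})
     \<le> count_const * (r * real q ^ CARD('d) +
        (real q * r) powr (- real CARD('d) / 2) * real q ^ CARD('d) * max 1 (ln (real q * r) ^ CARD('d)))"
    (is "real (card ?N) \<le> count_const * (?X + ?Y)")
proof -
  define s where "s = sqrt (real q * r)"
  define K where "K = nat \<lfloor>s\<rfloor>"
  \<comment> \<open>As K^2 <= qr, the sum of r and the linearization error is at most r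
    \<open>\<Lambda>\<close> / 6, so H - 1 <= 1/(\<open>\<Lambda>\<close> r) is what
    \<open>small\<close> requires.\<close>
  define \<Lambda> where "\<Lambda> = 6 * (1 + L * (real CARD('d))\<^sup>2)"
  \<comment> \<open>The summand 1 keeps \<open>H\<close> positive; for \<open>H = 1\<close> the smallness condition below is void.\<close>
  define H where "H = nat \<lfloor>1 / (\<Lambda> * r)\<rfloor> + 1"
  have s: "s \<ge> 1" "s\<^sup>2 = real q * r" using qr by (auto simp: s_def)
  have \<Lambda>: "\<Lambda> \<ge> 6" using L_nonneg by (simp add: \<Lambda>_def)
  \<comment> \<open>Because s >= 1, taking the floor loses at most a factor 2.\<close>
  have K: "K > 0" "real K \<le> s" "s \<le> 2 * real K"
  proof -
    have "1 \<le> \<lfloor>s\<rfloor>" using s by simp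
    then show "K > 0" "real K \<le> s" "s \<le> 2 * real K" unfolding K_def by linarith+
  qed
  have Hl: "real H - 1 \<le> 1 / (\<Lambda> * r)" and Hg: "1 / (\<Lambda> * r) \<le> real H" and "H > 0"
  proof -
    have "1 / (\<Lambda> * r) \<ge> 0" using \<Lambda> r by simp
    then show "real H - 1 \<le> 1 / (\<Lambda> * r)" "1 / (\<Lambda> * r) \<le> real H" "H > 0"
      unfolding H_def by linarith+
  qed
  have "s\<^sup>2 \<le> (real q)\<^sup>2"
  proof -
    have "real q * r \<le> real q * real q" using q r by (intro mult_left_mono) auto
    then show ?thesis using s by (simp add: power2_eq_square)
  qed
  then have "s \<le> real q" using power2_le_imp_le by fastforce
  then have "K \<le> q" using K by linarith
  have Kq: "(real K)\<^sup>2 \<le> real q * r"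
    using power_mono[OF K(2), of 2] s by simp
  have "L * (real CARD('d) * real K)\<^sup>2 / real q \<le> L * (real CARD('d))\<^sup>2 * r"
    using mult_left_mono[OF Kq, of "L * (real CARD('d))\<^sup>2"] L_nonneg q
    by (simp add: power_mult_distrib field_simps)
  moreover have "r * (\<Lambda> / 6) = r + L * (real CARD('d))\<^sup>2 * r"
    by (simp add: \<Lambda>_def algebra_simps)
  ultimately have "r + L * (real CARD('d) * real K)\<^sup>2 / real q \<le> r * (\<Lambda> / 6)" by linarith
  then have "6 * (real H - 1) * (r + L * (real CARD('d) * real K)\<^sup>2 / real q) \<le> 6 * (real H - 1) * (r * (\<Lambda> / 6))"
    using \<open>H > 0\<close> by (intro mult_left_mono) auto
  also have "\<dots> = (real H - 1) * (\<Lambda> * r)" by simp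
  also have "\<dots> \<le> 1" using Hl \<Lambda> r by (simp add: field_simps)
  finally have small: "6 * (real H - 1) * (r + L * (real CARD('d) * real K)\<^sup>2 / real q) \<le> 1" .
  let ?d = "CARD('d)"
  have "(5 * real q) ^ ?d / real H \<le> (5 * real q) ^ ?d * (\<Lambda> * r)"
  proof -
    have "1 / real H \<le> \<Lambda> * r" using Hg \<open>H > 0\<close> \<Lambda> r by (simp add: field_simps)
    from mult_left_mono[OF this, of "(5 * real q) ^ ?d"] show ?thesis by simp
  qed
  then have "4 * ((5 * real q) ^ ?d / real H) \<le> 4 * ((5 * real q) ^ ?d * (\<Lambda> * r))" by simp
  also have "\<dots> = (24 * (1 + L * (real CARD('d))\<^sup>2) * 5 ^ CARD('d)) * ?X"
    by (simp add: \<Lambda>_def power_mult_distrib)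
  also have "\<dots> \<le> count_const * ?X"
    using r by (intro mult_right_mono count_const_ge) auto
  finally have 1: "4 * ((5 * real q) ^ ?d / real H) \<le> count_const * ?X" .
  \<comment> \<open>The summand 1 in \<open>H\<close> is absorbed using r <= 1/2.\<close>
  have Hr: "real H \<le> 1 / r"
  proof -
    have "1 / (\<Lambda> * r) \<le> 1 / (6 * r)" using \<Lambda> r by (intro divide_left_mono) auto
    then have "real H \<le> 1 / (6 * r) + 1" using Hl by linarith
    also have "\<dots> \<le> 1 / r" using r by (simp add: field_simps)
    finally show ?thesis .
  qed
  have "real q / (c * (real K)\<^sup>2) \<le> real q / (c * (s / 2)\<^sup>2)"
    using c_pos K s by (intro divide_left_mono mult_left_mono power_mono mult_pos_pos) auto
  also have "\<dots> = 4 / c / r" using s q r c_pos by (simp add: power_divide field_simps)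
  finally have "2 * (real q / (c * (real K)\<^sup>2)) + 3 * real H \<le> (8 / c + 3) / r"
    using Hr by (simp add: add_divide_distrib)
  \<comment> \<open>The estimate is 1 + ln(qr)/2, and both terms are at most the maximum.\<close>
  moreover have harmK: "harm K \<le> 2 * max 1 (ln (real q * r))"
  proof -
    have "harm K \<le> 1 + ln s" using harm_le_ln[OF K(1)] K by (smt (verit) ln_mono of_nat_0_less_iff)
    also have "ln s = ln (real q * r) / 2" using q r by (simp add: s_def ln_sqrt)
    finally show ?thesis using qr by (simp add: max_def)
  qed
  ultimately have "8 * real M * real K * harm K * (2 * (real q / (c * (real K)\<^sup>2)) + 3 * real H)
      \<le> 8 * real M * s * (2 * max 1 (ln (real q * r))) * ((8 / c + 3) / r)"
    using K s c_pos by (intro mult_mono) (auto simp: harm_nonneg)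
  also have "\<dots> = 16 * real M * (8 / c + 3) * (1 / s * real q * max 1 (ln (real q * r)))"
  proof -
    have "s / r = real q / s" using s r by (simp add: field_simps power2_eq_square)
    moreover have "8 * real M * s * (2 * max 1 (ln (real q * r))) * ((8 / c + 3) / r) =
        16 * real M * (8 / c + 3) * (s / r * max 1 (ln (real q * r)))" by simp
    ultimately show ?thesis by simp
  qed
  finally have "(8 * real M * real K * harm K * (2 * (real q / (c * (real K)\<^sup>2)) + 3 * real H)) ^ ?d
      \<le> (16 * real M * (8 / c + 3) * (1 / s * real q * max 1 (ln (real q * r)))) ^ ?d"
    using c_pos by (intro power_mono) (auto simp: harm_nonneg)
  also have "\<dots> = (16 * real M * (8 / c + 3)) ^ ?d * ?Y"
  proof -
    \<comment> \<open>The power passes inside the maximum because the logarithm is nonnegative for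
      qr >= 1.\<close>
    have "max 1 (ln (real q * r)) ^ ?d = max 1 (ln (real q * r) ^ ?d)"
    proof (cases "ln (real q * r) \<le> 1")
      case True
      moreover have "ln (real q * r) \<ge> 0" using qr by simp
      ultimately show ?thesis by (simp add: power_le_one max_absorb1)
    qed (simp add: one_le_power max_absorb2)
    moreover have "(1 / s) ^ ?d = (real q * r) powr (- real ?d / 2)"
      using q r by (subst powr_neg_half_nat) (simp_all add: s_def)
    ultimately show ?thesis by (simp only: power_mult_distrib)
  qed
  finally have "4 * ((real P + 1) ^ ?d * (8 * real M * real K * harm K * (2 * (real q / (c * (real K)\<^sup>2)) + 3 * real H)) ^ ?d)
      \<le> 4 * ((real P + 1) ^ ?d * ((16 * real M * (8 / c + 3)) ^ ?d * ?Y))"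
    by (intro mult_left_mono) auto
  also have "\<dots> = (4 * (real P + 1) ^ ?d * (16 * real M * (8 / c + 3)) ^ ?d) * ?Y"
    by (simp only: mult.assoc)
  also have "\<dots> \<le> count_const * ?Y"
    by (intro mult_right_mono count_const_ge) (simp add: le_max_iff_disj)
  finally show ?thesis
    using 1 near_count_bound[OF q K(1) \<open>K \<le> q\<close> \<open>H > 0\<close> small, of l \<gamma>] by (simp only: distrib_left)
qed

text \<open>Since psi(q) <= 1/2, two admissible b for the same a differ by less than 1 and coincide,
  so it suffices to count the a.\<close>

lemma near_points_bound:
  assumes q: "q \<ge> 1" and r: "0 < \<psi> (real q)" "\<psi> (real q) \<le> 1 / 2"
  shows "finite (near_points f q \<psi> \<theta>)"
    and "real (card (near_points f q \<psi> \<theta>)) \<le> count_const * (\<psi> (real q) * real q ^ CARD('d) +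
           (real q * \<psi> (real q)) powr (- real CARD('d) / 2) * real q ^ CARD('d) *
             max 1 (ln (real q * \<psi> (real q)) ^ CARD('d)))"
proof -
  define r where "r = \<psi> (real q)"
  define l where "l = fst \<theta>"
  have r: "0 < r" "r \<le> 1 / 2" using assms by (auto simp: r_def)
  define N where "N = {a. shifted_point q l a \<in> unit_cube \<and>
        (\<exists>b. \<bar>real q * f (shifted_point q l a) - snd \<theta> - of_int b\<bar> < r)}"
  have fst_image: "fst ` near_points f q \<psi> \<theta> = N"
    by (force simp: near_points_def N_def l_def r_def image_iff)
  have inj: "inj_on fst (near_points f q \<psi> \<theta>)"
  proof (rule inj_onI)
    fix p p' assume p: "p \<in> near_points f q \<psi> \<theta>" "p' \<in> near_points f q \<psi> \<theta>" "fst p = fst p'"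
    then obtain a b b' where [simp]: "p = (a, b)" "p' = (a, b')" by (metis prod.collapse)
    have "\<bar>real_of_int b - real_of_int b'\<bar> < 1"
      using p r by (auto simp: near_points_def r_def)
    then have "b = b'" by linarith
    then show "p = p'" by simp
  qed
  have NE: "N \<subseteq> {a. shifted_point q l a \<in> unit_cube}" by (auto simp: N_def)
  have finE: "finite {a. shifted_point q l a \<in> unit_cube}"
    and cardE: "real (card {a. shifted_point q l a \<in> unit_cube}) \<le> (3 * real q) ^ CARD('d)"
    using shifted_points_in_cube[of q l] q by auto
  show "finite (near_points f q \<psi> \<theta>)"
    using inj fst_image NE finE by (metis finite_imageD finite_subset)
  have card: "card (near_points f q \<psi> \<theta>) = card N"
    using card_image[OF inj] fst_image by simp
  let ?X = "r * real q ^ CARD('d)"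
  let ?Y = "(real q * r) powr (- real CARD('d) / 2) * real q ^ CARD('d) * max 1 (ln (real q * r) ^ CARD('d))"
  have "real (card N) \<le> count_const * (?X + ?Y)"
  proof (cases "1 \<le> real q * r")
    case True
    then show ?thesis using near_count_bound_large[OF _ r True, of l "snd \<theta>"] q by (simp add: N_def)
  next
    case False
    \<comment> \<open>For qr < 1 the negative power of qr is at least 1, so the second term alone
      dominates q^d.\<close>
    then have "sqrt (real q * r) \<le> 1" "0 < sqrt (real q * r)" using q r by auto
    then have "1 \<le> (real q * r) powr (- real CARD('d) / 2)"
      using q r by (subst powr_neg_half_nat) (auto intro!: one_le_power)
    then have "1 * real q ^ CARD('d) * 1 \<le> ?Y"
      by (intro mult_mono) auto
    then have "real q ^ CARD('d) \<le> ?X + ?Y"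
      using r by (simp add: add_increasing)
    have "real (card N) \<le> (3 * real q) ^ CARD('d)"
      using cardE card_mono[OF finE NE] by linarith
    also have "\<dots> = 3 ^ CARD('d) * real q ^ CARD('d)" by (simp add: power_mult_distrib)
    also have "\<dots> \<le> count_const * (?X + ?Y)"
      using count_const_ge \<open>real q ^ CARD('d) \<le> ?X + ?Y\<close> by (intro mult_mono) auto
    finally show ?thesis .
  qed
  then show "real (card (near_points f q \<psi> \<theta>)) \<le> count_const * (\<psi> (real q) * real q ^ CARD('d) +
           (real q * \<psi> (real q)) powr (- real CARD('d) / 2) * real q ^ CARD('d) *
             max 1 (ln (real q * \<psi> (real q)) ^ CARD('d)))"
    unfolding card r_def .
qed

end

text \<open>\<open>M\<close> and \<open>P\<close> are natural numbers because they count whole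
  periods and grid pieces; the compactness bound on the gradient and 1/\<open>\<delta>\<close> are
  rounded up accordingly.\<close>

lemma C2_within_curved_graph:
  fixes f :: "real ^ 'd \<Rightarrow> real"
  assumes C2: "C2_within unit_cube f"
    and det: "\<And>\<alpha>. \<alpha> \<in> unit_cube \<Longrightarrow> det (hessian_within unit_cube f \<alpha>) \<noteq> 0"
  obtains L c M P where "curved_graph f (\<lambda>i. partial_within unit_cube i f) L c M P"
proof -
  obtain L where L: "L \<ge> 0" "\<And>x x'. x \<in> unit_cube \<Longrightarrow> x' \<in> unit_cube \<Longrightarrow>
      \<bar>f x - f x' - (\<Sum>i\<in>UNIV. partial_within unit_cube i f x' * (x $ i - x' $ i))\<bar>
        \<le> L * (\<Sum>i\<in>UNIV. \<bar>x $ i - x' $ i\<bar>)\<^sup>2"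
    using C2_within_linearization[OF C2] by blast
  obtain c \<delta> where c: "c > 0" "\<delta> > 0"
    and sep: "\<And>x x' s i. x \<in> unit_cube \<Longrightarrow> x' \<in> unit_cube \<Longrightarrow> (\<And>i. \<bar>x $ i - x' $ i\<bar> \<le> \<delta>) \<Longrightarrow>
      (\<And>j. \<bar>partial_within unit_cube j f x - partial_within unit_cube j f x'\<bar> \<le> s) \<Longrightarrow>
      c * \<bar>x $ i - x' $ i\<bar> \<le> s"
    by (rule gradient_locally_injective[OF C2 det]) (assumption, erule (1) that, blast)
  obtain P where P: "P > 0" "1 / real P \<le> \<delta>"
    using nat_approx_posE[OF c(2)] by (metis less_imp_le zero_less_Suc)
  have "\<exists>B. \<forall>x\<in>unit_cube. \<bar>partial_within unit_cube i f x\<bar> \<le> B" for i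
  proof -
    have "compact (partial_within unit_cube i f ` unit_cube)"
      using C2 by (intro compact_continuous_image) (auto simp: C2_within_def)
    then show ?thesis by (auto dest!: compact_imp_bounded simp: bounded_iff)
  qed
  then obtain B where B: "\<And>i x. x \<in> unit_cube \<Longrightarrow> \<bar>partial_within unit_cube i f x\<bar> \<le> B i" by metis
  obtain M where M: "Max (range B) < real M" using reals_Archimedean2 by blast
  have "curved_graph f (\<lambda>i. partial_within unit_cube i f) L c M P"
  proof
    fix x :: "real ^ 'd" and i assume "x \<in> unit_cube"
    then have "\<bar>partial_within unit_cube i f x\<bar> \<le> B i" by (rule B)
    also have "B i \<le> Max (range B)" by (rule Max_ge) auto
    finally show "\<bar>partial_within unit_cube i f x\<bar> < real M" using M by linarith
  next
    fix x x' :: "real ^ 'd" and s i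
    assume "x \<in> unit_cube" "x' \<in> unit_cube" "\<And>i. \<bar>x $ i - x' $ i\<bar> \<le> 1 / real P"
      "\<And>j. \<bar>partial_within unit_cube j f x - partial_within unit_cube j f x'\<bar> \<le> s"
    then show "c * \<bar>x $ i - x' $ i\<bar> \<le> s" using P by (intro sep) (auto intro: order_trans)
  qed (use L c P in auto)
  then show ?thesis by (rule that)
qed

theorem theorem3:
  fixes f :: "real ^ 'd \<Rightarrow> real" and \<eta> :: real
  assumes "C2_within unit_cube f"
    and "\<eta> > 0"
    and "\<And>\<alpha>. \<alpha> \<in> unit_cube \<Longrightarrow> \<bar>det (hessian_within unit_cube f \<alpha>)\<bar> \<ge> \<eta>"
  shows "\<exists>C>0. \<forall>(\<theta> :: (real ^ 'd) \<times> real) (\<psi> :: real \<Rightarrow> real) (q :: nat).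
    (\<forall>r\<ge>0. \<psi> r \<ge> 0) \<longrightarrow> (\<psi> \<longlongrightarrow> 0) at_top \<longrightarrow>
    q \<ge> 1 \<longrightarrow> 0 < \<psi> (real q) \<longrightarrow> \<psi> (real q) \<le> 1 / 2 \<longrightarrow>
    finite (near_points f q \<psi> \<theta>) \<and>
    real (card (near_points f q \<psi> \<theta>)) \<le>
      C * (\<psi> (real q) * real q ^ CARD('d) +
           (real q * \<psi> (real q)) powr (- real CARD('d) / 2) * real q ^ CARD('d) *
             max 1 (ln (real q * \<psi> (real q)) ^ CARD('d)))"
proof -
  have "det (hessian_within unit_cube f \<alpha>) \<noteq> 0" if "\<alpha> \<in> unit_cube" for \<alpha>
    using assms(2) assms(3)[OF that] by auto
  then obtain L c M P where "curved_graph f (\<lambda>i. partial_within unit_cube i f) L c M P"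
    using C2_within_curved_graph[OF assms(1)] by blast
  then interpret curved_graph f "\<lambda>i. partial_within unit_cube i f" L c M P .
  \<comment> \<open>\<open>L\<close>, \<open>c\<close>, \<open>M\<close> and \<open>P\<close> are
    fixed before \<open>\<theta>\<close>, \<open>\<psi>\<close> and \<open>q\<close> are introduced,
    so this witness is uniform in them.\<close>
  show ?thesis
    using count_const_ge(4) near_points_bound by (intro exI[of _ count_const]) blast
qed

end
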